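(* Let $S_1$ and $S_2$ be finite sets, let $E_1\subset F_{S_1}$ and $E_2\subset F_{S_2}$ be subsets such that the groups $\langle S_1\mid E_1\rangle$ and $\langle S_2\mid E_2\rangle$ are isomorphic, and let $\nu\colon\mathbb{R}_{>0}\times\mathbb{N}\to\mathbb{N}\cup\{0,\infty\}$ be monotone non-decreasing in the first argument. Then $E_1$ is $\nu$-flexibly BS-rigid if and only if $E_2$ is $\nu$-flexibly BS-rigid; and $E_1$ is $\nu$-flexibly stable if and only if $E_2$ is $\nu$-flexibly stable.
   Context: For a finite set $S=\{s_1,\dots,s_k\}$, $F_S$ is the free group on $S$; $[n]=\{1,\dots,n\}$; $\mathrm{Sym}(n)$ is the symmetric group on $[n]$. For $\sigma\in\mathrm{Sym}(n)$ and $\tau\in\mathrm{Sym}(N)$ with $N\ge n$, $d(\sigma,\tau)=d(\tau,\sigma)=\frac1n|\{x\in[n]\mid\sigma x\neq\tau x\}|$. For $\overline\sigma\in\mathrm{Sym}(n)^k$ and $w\in F_S$, $w(\overline\sigma)$ is the image of $w$ under the homomorphism $F_S\to\mathrm{Sym}(n)$ with $s_i\mapsto\sigma_i$. For $E\subseteq F_S$, $\mathrm{Sol}_E(n)=\{\overline\sigma\in\mathrm{Sym}(n)^k\mid\forall w\in E,\ w(\overline\sigma)=\mathrm{id}\}$. For $\varepsilon>0$ let $\mathrm{Sol}_E^{<\varepsilon,\nu\text{-flex}}(n)$ be the set of $\overline\sigma\in\mathrm{Sym}(n)^k$ for which there exist $N\in\mathbb{N}$ with $n\le N\le n+\nu(\varepsilon,n)$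 and $\overline\tau\in\mathrm{Sol}_E(N)$ with $\sum_{i=1}^kd(\sigma_i,\tau_i)<\varepsilon$; let $\mathrm{Sol}_E^{\ge\varepsilon,\nu\text{-flex}}(n)=\mathrm{Sym}(n)^k\setminus\mathrm{Sol}_E^{<\varepsilon,\nu\text{-flex}}(n)$. $\nu$-flexible BS-rigidity of a set: for finite $P\subseteq F_S$ let $N_{\overline\sigma,P}$ be the distribution on $2^P$ of $\{w\in P\mid w(\overline\sigma)x=x\}$ with $x$ uniform in $[n]$, and let $d_{\mathrm{TV}}$ denote total variation distance (half the $\ell^1$ distance). $E$ is $\nu$-flexibly BS-rigid if for every $\varepsilon>0$ there exist a finite $P\subseteq F_S$ and $\delta>0$ such that $d_{\mathrm{TV}}(N_{\overline\sigma,P},N_{\overline\tau,P})\ge\delta$ for every $n\in\mathbb{N}$, $\overline\sigma\in\mathrm{Sol}_E^{\ge\varepsilon,\nu\text{-flex}}(n)$, $\overline\tau\in\mathrm{Sol}_E(n)$. $\nu$-flexible stability of a set: the algorithm Sample and Substitute with finite word set $E_0$ and repetition factor $s\in\mathbb{N}$, on input $n$ and $\overline\sigma\in\mathrm{Sym}(n)^k$, samples $(w_1,x_1),\dots,(w_s,x_s)$ uniformly and independently from $E_0\times[n]$ and accepts if $w_j(\overline\sigma)x_j=x_j$ for all $1\le j\le s$, and rejects otherwise (for $E_0=\emptyset$ it always accepts). $E$ is $\nu$-flexibly stable if for every $\varepsilon>0$ there exist $s\in\mathbb{N}$ and a finite subset $E_0\subseteq E$ such that, for all $n$, this algorithm accepts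 every $\overline\sigma\in\mathrm{Sol}_E(n)$ with probability at least $0.99$ and rejects every $\overline\sigma\in\mathrm{Sol}_E^{\ge\varepsilon,\nu\text{-flex}}(n)$ with probability at least $0.99$. (For finite $E$ one may equivalently take $E_0=E$.) *)

theory Defs
  imports
    "HOL-Algebra.Sym_Groups"
    "HOL-Library.Extended_Nat"
    "HOL-Probability.Probability_Mass_Function"
begin

section \<open>Free groups and presentations\<close>

text \<open>A letter \<open>(s, True)\<close> stands for the generator \<open>s\<close>, and \<open>(s, False)\<close> for its inverse.
  The elements of the free group are the freely reduced words.\<close>

type_synonym 'a fword = "('a \<times> bool) list"

definition inv_letter :: "'a \<times> bool \<Rightarrow> 'a \<times> bool" where
  "inv_letter x = (fst x, \<not> snd x)"

fun reduced :: "'a fword \<Rightarrow> bool" where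
  "reduced (x # y # w) \<longleftrightarrow> y \<noteq> inv_letter x \<and> reduced (y # w)"
| "reduced _ \<longleftrightarrow> True"

fun cons_letter :: "'a \<times> bool \<Rightarrow> 'a fword \<Rightarrow> 'a fword" where
  "cons_letter x [] = [x]"
| "cons_letter x (y # w) = (if y = inv_letter x then w else x # y # w)"

definition free_group :: "'a set \<Rightarrow> 'a fword monoid" where
  "free_group S = \<lparr>carrier = {w. reduced w \<and> set w \<subseteq> S \<times> UNIV},
                   mult = (\<lambda>u v. foldr cons_letter u v), one = []\<rparr>"

definition word_eval :: "('b, 'c) monoid_scheme \<Rightarrow> ('a \<Rightarrow> 'b) \<Rightarrow> 'a fword \<Rightarrow> 'b" where
  "word_eval G f w =
     foldr (\<lambda>(s, b) g. (if b then f s else inv\<^bsub>G\<^esub> f s) \<otimes>\<^bsub>G\<^esub> g) w \<one>\<^bsub>G\<^esub>"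

definition normal_closure :: "('a, 'b) monoid_scheme \<Rightarrow> 'a set \<Rightarrow> 'a set" where
  "normal_closure G E = \<Inter> {N. N \<lhd> G \<and> E \<subseteq> N}"

definition presented_group :: "'a set \<Rightarrow> 'a fword set \<Rightarrow> 'a fword set monoid" where
  "presented_group S E = free_group S Mod normal_closure (free_group S) E"

text \<open>\<^const>\<open>free_group\<close> is a group, and \<^const>\<open>word_eval\<close> is the unique homomorphism
  extending a map on the generators.\<close>

lemma inv_letter_inv_letter [simp]: "inv_letter (inv_letter x) = x"
  by (simp add: inv_letter_def)

lemma inv_letter_in [simp]: "inv_letter x \<in> S \<times> UNIV \<longleftrightarrow> x \<in> S \<times> UNIV"
  by (cases x) (simp add: inv_letter_def)

lemma reduced_tl: "reduced (x # w) \<Longrightarrow> reduced w"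
  by (cases w) auto

lemma reduced_cons_letter: "reduced w \<Longrightarrow> reduced (cons_letter x w)"
  by (cases w) (auto dest: reduced_tl)

lemma cons_letter_reduced: "reduced (x # w) \<Longrightarrow> cons_letter x w = x # w"
  by (cases w) auto

lemma cons_letter_cancel:
  assumes "reduced w"
  shows "cons_letter x (cons_letter (inv_letter x) w) = w"
  using assms by (cases w) (auto simp: cons_letter_reduced)

lemma reduced_foldr: "reduced v \<Longrightarrow> reduced (foldr cons_letter u v)"
  by (induction u) (auto intro: reduced_cons_letter)

lemma set_cons_letter: "set (cons_letter x w) \<subseteq> insert x (set w)"
  by (cases w) auto

lemma set_foldr_cons_letter: "set (foldr cons_letter u v) \<subseteq> set u \<union> set v"
proof (induction u)
  case (Cons x u)
  then show ?case using set_cons_letter[of x "foldr cons_letter u v"] by auto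
qed simp

lemma foldr_cons_letter_assoc:
  assumes "reduced v" "reduced w"
  shows "foldr cons_letter (foldr cons_letter u v) w = foldr cons_letter u (foldr cons_letter v w)"
proof (induction u)
  case (Cons x u)
  have *: "foldr cons_letter (cons_letter x t) w = cons_letter x (foldr cons_letter t w)" for t
  proof (cases t)
    case (Cons y t')
    then show ?thesis
      using cons_letter_cancel[of "foldr cons_letter t' w" x] reduced_foldr[OF assms(2)]
      by auto
  qed simp
  show ?case by (simp add: * Cons.IH)
qed simp

lemma foldr_cons_letter_Nil: "reduced u \<Longrightarrow> foldr cons_letter u [] = u"
proof (induction u)
  case (Cons x u)
  then show ?case using reduced_tl[OF Cons.prems] cons_letter_reduced[OF Cons.prems] by simp
qed simp

lemma foldr_cons_letter_inverse:
  "reduced w \<Longrightarrow> foldr cons_letter (map inv_letter (rev u)) (foldr cons_letter u w) = w"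
proof (induction u arbitrary: w)
  case (Cons x u)
  have "cons_letter (inv_letter x) (cons_letter x (foldr cons_letter u w)) = foldr cons_letter u w"
    using cons_letter_cancel[of "foldr cons_letter u w" "inv_letter x"] Cons.prems
    by (simp add: reduced_foldr)
  then show ?case using Cons by simp
qed simp

lemma group_free_group: "group (free_group S)"
proof (rule groupI)
  fix u v assume "u \<in> carrier (free_group S)" "v \<in> carrier (free_group S)"
  then show "u \<otimes>\<^bsub>free_group S\<^esub> v \<in> carrier (free_group S)"
    using set_foldr_cons_letter[of u v] by (auto simp: free_group_def reduced_foldr)
next
  fix u assume u: "u \<in> carrier (free_group S)"
  define u' where "u' = foldr cons_letter (map inv_letter (rev u)) []"
  have "set u' \<subseteq> inv_letter ` set u"
    using set_foldr_cons_letter[of "map inv_letter (rev u)" "[]"] by (simp add: u'_def)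
  also have "\<dots> \<subseteq> S \<times> UNIV" using u by (auto simp: free_group_def inv_letter_def)
  finally have "u' \<in> carrier (free_group S)" by (simp add: free_group_def u'_def reduced_foldr)
  moreover have "foldr cons_letter u' u = []"
  proof -
    have "foldr cons_letter u' u = foldr cons_letter (map inv_letter (rev u)) (foldr cons_letter [] u)"
      unfolding u'_def using u by (intro foldr_cons_letter_assoc) (auto simp: free_group_def)
    also have "\<dots> = foldr cons_letter (map inv_letter (rev u)) (foldr cons_letter u [])"
      using u by (simp add: foldr_cons_letter_Nil free_group_def)
    finally show ?thesis by (simp add: foldr_cons_letter_inverse)
  qed
  ultimately show "\<exists>y\<in>carrier (free_group S). y \<otimes>\<^bsub>free_group S\<^esub> u = \<one>\<^bsub>free_group S\<^esub>"
    by (intro bexI[of _ u']) (auto simp: free_group_def)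
qed (auto simp: free_group_def foldr_cons_letter_assoc)

lemma word_eval_simps:
  "word_eval G f [] = \<one>\<^bsub>G\<^esub>"
  "word_eval G f (x # w) =
     (if snd x then f (fst x) else inv\<^bsub>G\<^esub> f (fst x)) \<otimes>\<^bsub>G\<^esub> word_eval G f w"
  by (simp_all add: word_eval_def case_prod_unfold)

context
  fixes G :: "('b, 'c) monoid_scheme" (structure) and f :: "'a \<Rightarrow> 'b" and S :: "'a set"
  assumes G: "group G" and f: "f \<in> S \<rightarrow> carrier G"
begin

interpretation group G by (rule G)

lemma word_eval_closed: "set w \<subseteq> S \<times> UNIV \<Longrightarrow> word_eval G f w \<in> carrier G"
proof (induction w)
  case (Cons x w)
  then have "f (fst x) \<in> carrier G" using f by (auto simp: mem_Times_iff)
  then show ?case using Cons by (auto simp: word_eval_simps)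
qed (simp add: word_eval_simps)

lemma word_eval_cons_letter:
  assumes "x \<in> S \<times> UNIV" "set w \<subseteq> S \<times> UNIV"
  shows "word_eval G f (cons_letter x w) = word_eval G f (x # w)"
proof (cases w)
  case (Cons y w')
  have "f (fst x) \<in> carrier G" "word_eval G f w' \<in> carrier G"
    using f assms Cons by (auto simp: mem_Times_iff word_eval_closed)
  then show ?thesis using Cons
    by (auto simp: word_eval_simps inv_letter_def m_assoc[symmetric])
qed simp

lemma word_eval_hom: "word_eval G f \<in> hom (free_group S) G"
proof (rule homI)
  fix u v assume "u \<in> carrier (free_group S)" "v \<in> carrier (free_group S)"
  then have "set u \<subseteq> S \<times> UNIV" and v: "set v \<subseteq> S \<times> UNIV" by (auto simp: free_group_def)
  then have "word_eval G f (foldr cons_letter u v) = word_eval G f u \<otimes> word_eval G f v"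
  proof (induction u)
    case Nil
    then show ?case by (simp add: word_eval_simps word_eval_closed)
  next
    case (Cons x u)
    have "set (foldr cons_letter u v) \<subseteq> S \<times> UNIV"
      using set_foldr_cons_letter[of u v] Cons.prems by auto
    moreover have "f (fst x) \<in> carrier G" using Cons.prems f by (auto simp: mem_Times_iff)
    ultimately show ?case using Cons
      by (auto simp: word_eval_cons_letter word_eval_simps m_assoc word_eval_closed)
  qed
  then show "word_eval G f (u \<otimes>\<^bsub>free_group S\<^esub> v) = word_eval G f u \<otimes> word_eval G f v"
    by (simp add: free_group_def)
qed (auto simp: word_eval_closed free_group_def)

lemma word_eval_generator: "s \<in> S \<Longrightarrow> word_eval G f [(s, True)] = f s"
  using funcset_mem[OF f, of s] by (simp add: word_eval_simps)

lemma word_eval_unique: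
  assumes h: "h \<in> hom (free_group S) G" and gen: "\<And>s. s \<in> S \<Longrightarrow> h [(s, True)] = f s"
    and w: "w \<in> carrier (free_group S)"
  shows "h w = word_eval G f w"
proof -
  interpret F: group "free_group S" by (rule group_free_group)
  interpret h: group_hom "free_group S" G h by unfold_locales (rule h)
  have letter: "h [(s, b)] = (if b then f s else inv f s)" if s: "s \<in> S" for s b
  proof (cases b)
    case False
    have c: "[(s, c)] \<in> carrier (free_group S)" for c using s by (simp add: free_group_def)
    have "[(s, False)] \<otimes>\<^bsub>free_group S\<^esub> [(s, True)] = \<one>\<^bsub>free_group S\<^esub>"
      by (simp add: free_group_def inv_letter_def)
    then have "[(s, False)] = inv\<^bsub>free_group S\<^esub> [(s, True)]"
      using F.inv_equality[of "[(s, False)]" "[(s, True)]"] c by simp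
    then show ?thesis using False h.hom_inv[OF c] gen[OF s] by simp
  qed (use gen[OF s] in simp)
  show ?thesis using w
  proof (induction w)
    case Nil
    then show ?case using h.hom_one by (simp add: free_group_def word_eval_simps)
  next
    case (Cons x w)
    have w: "w \<in> carrier (free_group S)" and x: "[x] \<in> carrier (free_group S)"
      using Cons.prems by (auto simp: free_group_def dest: reduced_tl)
    have "x # w = [x] \<otimes>\<^bsub>free_group S\<^esub> w"
      using Cons.prems by (simp add: free_group_def cons_letter_reduced)
    then have "h (x # w) = h [x] \<otimes> h w" using h.hom_mult[OF x w] by simp
    moreover have "fst x \<in> S" using x by (auto simp: free_group_def)
    ultimately show ?case using Cons.IH[OF w] letter[of "fst x" "snd x"]
      by (simp add: word_eval_simps)
  qed
qed

end

section \<open>Permutation solutions\<close>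

text \<open>Tuples in \<open>Sym(n)\<^sup>k\<close> are indexed by the set \<open>S\<close> itself, as extensional functions on \<open>S\<close>.\<close>

definition sym_tuples :: "'a set \<Rightarrow> nat \<Rightarrow> ('a \<Rightarrow> nat \<Rightarrow> nat) set" where
  "sym_tuples S n = (S \<rightarrow>\<^sub>E carrier (sym_group n))"

definition sol :: "'a set \<Rightarrow> 'a fword set \<Rightarrow> nat \<Rightarrow> ('a \<Rightarrow> nat \<Rightarrow> nat) set" where
  "sol S E n = {\<sigma> \<in> sym_tuples S n. \<forall>w\<in>E. word_eval (sym_group n) \<sigma> w = id}"

text \<open>Here \<open>n\<close> is the smaller of the two degrees.\<close>

definition perm_dist :: "nat \<Rightarrow> (nat \<Rightarrow> nat) \<Rightarrow> (nat \<Rightarrow> nat) \<Rightarrow> real" where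
  "perm_dist n p q = real (card {x \<in> {1..n}. p x \<noteq> q x}) / real n"

definition sol_near ::
  "'a set \<Rightarrow> 'a fword set \<Rightarrow> (real \<Rightarrow> nat \<Rightarrow> enat) \<Rightarrow> real \<Rightarrow> nat \<Rightarrow> ('a \<Rightarrow> nat \<Rightarrow> nat) set" where
  "sol_near S E \<nu> \<epsilon> n = {\<sigma> \<in> sym_tuples S n.
     \<exists>N. n \<le> N \<and> enat N \<le> enat n + \<nu> \<epsilon> n \<and>
         (\<exists>\<tau>\<in>sol S E N. (\<Sum>s\<in>S. perm_dist n (\<sigma> s) (\<tau> s)) < \<epsilon>)}"

definition sol_far ::
  "'a set \<Rightarrow> 'a fword set \<Rightarrow> (real \<Rightarrow> nat \<Rightarrow> enat) \<Rightarrow> real \<Rightarrow> nat \<Rightarrow> ('a \<Rightarrow> nat \<Rightarrow> nat) set" where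
  "sol_far S E \<nu> \<epsilon> n = sym_tuples S n - sol_near S E \<nu> \<epsilon> n"

section \<open>Flexible BS-rigidity\<close>

definition stabilizer_pmf ::
  "nat \<Rightarrow> ('a \<Rightarrow> nat \<Rightarrow> nat) \<Rightarrow> 'a fword set \<Rightarrow> 'a fword set pmf" where
  "stabilizer_pmf n \<sigma> P =
     map_pmf (\<lambda>x. {w \<in> P. word_eval (sym_group n) \<sigma> w x = x}) (pmf_of_set {1..n})"

definition tv_dist :: "'a pmf \<Rightarrow> 'a pmf \<Rightarrow> real" where
  "tv_dist p q = (\<Sum>\<^sub>\<infinity>x. \<bar>pmf p x - pmf q x\<bar>) / 2"

definition flexibly_BS_rigid ::
  "(real \<Rightarrow> nat \<Rightarrow> enat) \<Rightarrow> 'a set \<Rightarrow> 'a fword set \<Rightarrow> bool" where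
  "flexibly_BS_rigid \<nu> S E \<longleftrightarrow>
     (\<forall>\<epsilon>>0. \<exists>P \<delta>. finite P \<and> P \<subseteq> carrier (free_group S) \<and> \<delta> > 0 \<and>
        (\<forall>n\<ge>1. \<forall>\<sigma>\<in>sol_far S E \<nu> \<epsilon> n. \<forall>\<tau>\<in>sol S E n.
           tv_dist (stabilizer_pmf n \<sigma> P) (stabilizer_pmf n \<tau> P) \<ge> \<delta>))"

section \<open>Flexible stability\<close>

text \<open>The distribution of the answer (\<open>True\<close> for acceptance). The case \<open>E0 = {}\<close> is separate
  because \<^const>\<open>pmf_of_set\<close> is unspecified on the empty set.\<close>

definition sample_and_substitute ::
  "'a fword set \<Rightarrow> nat \<Rightarrow> nat \<Rightarrow> ('a \<Rightarrow> nat \<Rightarrow> nat) \<Rightarrow> bool pmf" where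
  "sample_and_substitute E0 s n \<sigma> =
     (if E0 = {} then return_pmf True
      else map_pmf (\<lambda>xs. \<forall>(w, x)\<in>set xs. word_eval (sym_group n) \<sigma> w x = x)
             (replicate_pmf s (pmf_of_set (E0 \<times> {1..n}))))"

definition flexibly_stable ::
  "(real \<Rightarrow> nat \<Rightarrow> enat) \<Rightarrow> 'a set \<Rightarrow> 'a fword set \<Rightarrow> bool" where
  "flexibly_stable \<nu> S E \<longleftrightarrow>
     (\<forall>\<epsilon>>0. \<exists>s\<ge>1. \<exists>E0. finite E0 \<and> E0 \<subseteq> E \<and>
        (\<forall>n\<ge>1.
           (\<forall>\<sigma>\<in>sol S E n. pmf (sample_and_substitute E0 s n \<sigma>) True \<ge> 0.99) \<and>
           (\<forall>\<sigma>\<in>sol_far S E \<nu> \<epsilon> n. pmf (sample_and_substitute E0 s n \<sigma>) False \<ge> 0.99)))"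

end

theory Submission
  imports Defs
begin

text \<open>Lift the isomorphism and its inverse to substitutions \<open>f : S1 \<rightarrow> F(S2)\<close> and \<open>g : S2 \<rightarrow> F(S1)\<close>.
  Pulling a tuple \<open>\<sigma>\<close> back along \<open>g\<close> and then along \<open>f\<close> returns a tuple close to \<open>\<sigma>\<close> as long as \<open>\<sigma>\<close>
  almost satisfies the finitely many relators \<open>s\<^sup>-\<^sup>1 g(f(s))\<close>, and substitution is Lipschitz for the
  Hamming distance, also between different degrees. So if \<open>\<sigma>\<close> is far from the solutions of \<open>E1\<close>, then
  either its pullback is far from the solutions of \<open>E2\<close>, or some \<open>s\<^sup>-\<^sup>1 g(f(s))\<close> moves many points.
  The second case is detected by stabilizer statistics, and, since these words lie in the normal
  closure of \<open>E1\<close>, also by finitely many elements of \<open>E1\<close>. Only a retraction of one group onto the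
  other is needed for each of the two implications.\<close>

section \<open>Normal closures and lifts of homomorphisms\<close>

lemma (in group) normal_normal_closure:
  assumes "E \<subseteq> carrier G"
  shows "normal_closure G E \<lhd> G"
proof -
  let ?A = "{N. N \<lhd> G \<and> E \<subseteq> N}"
  have "carrier G \<lhd> G"
    by (auto simp: normal_inv_iff subgroup_self)
  \<comment> \<open>Without a member the intersection would be \<open>UNIV\<close> rather than a
    subgroup; the whole carrier serves as one.\<close>
  then have "?A \<noteq> {}" using assms by blast
  moreover have "subgroup N G" if "N \<in> ?A" for N
    using that by (simp add: normal_imp_subgroup)
  ultimately have "subgroup (\<Inter>?A) G" by (intro subgroups_Inter) auto
  moreover have "\<forall>x\<in>carrier G. \<forall>h\<in>\<Inter>?A. x \<otimes> h \<otimes> inv x \<in> \<Inter>?A"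
    using normal_invE(2) by blast
  ultimately show ?thesis unfolding normal_closure_def normal_inv_iff by blast
qed

lemma normal_closure_least: "N \<lhd> G \<Longrightarrow> E \<subseteq> N \<Longrightarrow> normal_closure G E \<subseteq> N"
  unfolding normal_closure_def by blast

lemma subset_normal_closure: "E \<subseteq> normal_closure G E"
  unfolding normal_closure_def by blast

lemma group_presented_group:
  assumes "E \<subseteq> carrier (free_group S)"
  shows "group (presented_group S E)"
  unfolding presented_group_def
  by (intro normal.factorgroup_is_group group.normal_normal_closure group_free_group assms)

text \<open>Free groups are projective: for each generator choose a representative in
  \<open>free_group S2\<close> of its image under \<open>h\<close>. The two resulting maps to the
  quotient are homomorphisms on a free group that agree on generators, hence everywhere.\<close>

lemma presented_group_hom_lift:
  assumes E1: "E1 \<subseteq> carrier (free_group S1)" and E2: "E2 \<subseteq> carrier (free_group S2)"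
    and h: "h \<in> hom (presented_group S1 E1) (presented_group S2 E2)"
  obtains f where "f \<in> S1 \<rightarrow> carrier (free_group S2)"
    and "\<And>w. w \<in> carrier (free_group S1) \<Longrightarrow>
      normal_closure (free_group S2) E2 #>\<^bsub>free_group S2\<^esub> word_eval (free_group S2) f w
      = h (normal_closure (free_group S1) E1 #>\<^bsub>free_group S1\<^esub> w)"
proof -
  let ?F1 = "free_group S1" and ?F2 = "free_group S2"
  let ?N1 = "normal_closure ?F1 E1" and ?N2 = "normal_closure ?F2 E2"
  interpret F1: group ?F1 by (rule group_free_group)
  interpret F2: group ?F2 by (rule group_free_group)
  interpret N1: normal ?N1 ?F1 by (rule F1.normal_normal_closure[OF E1])
  interpret N2: normal ?N2 ?F2 by (rule F2.normal_normal_closure[OF E2])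
  interpret P2: group "presented_group S2 E2" by (rule group_presented_group[OF E2])
  have q1: "(\<lambda>w. ?N1 #>\<^bsub>?F1\<^esub> w) \<in> hom ?F1 (presented_group S1 E1)"
    and q2: "(\<lambda>w. ?N2 #>\<^bsub>?F2\<^esub> w) \<in> hom ?F2 (presented_group S2 E2)"
    unfolding presented_group_def by (rule N1.r_coset_hom_Mod, rule N2.r_coset_hom_Mod)
  have hq1: "(\<lambda>w. h (?N1 #>\<^bsub>?F1\<^esub> w)) \<in> hom ?F1 (presented_group S2 E2)"
    using hom_compose[OF q1 h] by (simp add: comp_def)
  have "\<exists>v\<in>carrier ?F2. ?N2 #>\<^bsub>?F2\<^esub> v = h (?N1 #>\<^bsub>?F1\<^esub> [(s, True)])" if "s \<in> S1" for s
  proof -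
    have "[(s, True)] \<in> carrier ?F1" using that by (simp add: free_group_def)
    then have "h (?N1 #>\<^bsub>?F1\<^esub> [(s, True)]) \<in> carrier (presented_group S2 E2)"
      by (rule hom_in_carrier[OF hq1])
    then show ?thesis unfolding presented_group_def carrier_FactGroup by auto
  qed
  then obtain f where f: "\<And>s. s \<in> S1 \<Longrightarrow> f s \<in> carrier ?F2"
    "\<And>s. s \<in> S1 \<Longrightarrow> ?N2 #>\<^bsub>?F2\<^esub> f s = h (?N1 #>\<^bsub>?F1\<^esub> [(s, True)])"
    by metis
  then have fS: "f \<in> S1 \<rightarrow> carrier ?F2" by blast
  have e: "(\<lambda>w. ?N2 #>\<^bsub>?F2\<^esub> word_eval ?F2 f w) \<in> hom ?F1 (presented_group S2 E2)"
    using hom_compose[OF word_eval_hom[OF F2.group_axioms fS] q2] by (simp add: comp_def)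
  have gen: "(\<lambda>s. h (?N1 #>\<^bsub>?F1\<^esub> [(s, True)])) \<in> S1 \<rightarrow> carrier (presented_group S2 E2)"
    using hom_in_carrier[OF hq1] by (auto simp: free_group_def)
  have "?N2 #>\<^bsub>?F2\<^esub> word_eval ?F2 f w = h (?N1 #>\<^bsub>?F1\<^esub> w)" if w: "w \<in> carrier ?F1" for w
  proof -
    have "?N2 #>\<^bsub>?F2\<^esub> word_eval ?F2 f w
        = word_eval (presented_group S2 E2) (\<lambda>s. h (?N1 #>\<^bsub>?F1\<^esub> [(s, True)])) w"
      by (rule word_eval_unique[OF P2.group_axioms gen e _ w])
         (simp add: f word_eval_generator[OF F2.group_axioms fS])
    also have "\<dots> = h (?N1 #>\<^bsub>?F1\<^esub> w)"
      by (rule word_eval_unique[OF P2.group_axioms gen hq1 _ w, symmetric]) simp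
    finally show ?thesis .
  qed
  with fS show ?thesis by (rule that)
qed

section \<open>Retractions between presented groups\<close>

text \<open>The last assumption makes \<open>g\<close> after \<open>f\<close> induce the identity on
  the first group, which is thus a retract of the second. The maps are kept as words in free groups
  rather than as maps of quotients, because words can be evaluated on arbitrary tuples, also on
  those that violate the relators.\<close>

locale presentation_retract =
  fixes S1 :: "'a set" and E1 :: "'a fword set" and S2 :: "'b set" and E2 :: "'b fword set"
    and f :: "'a \<Rightarrow> 'b fword" and g :: "'b \<Rightarrow> 'a fword"
  assumes finite_S1: "finite S1" and finite_S2: "finite S2"
    and E1: "E1 \<subseteq> carrier (free_group S1)" and E2: "E2 \<subseteq> carrier (free_group S2)"
    and f: "f \<in> S1 \<rightarrow> carrier (free_group S2)" and g: "g \<in> S2 \<rightarrow> carrier (free_group S1)"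
    and f_relator: "\<And>w. w \<in> E1 \<Longrightarrow>
      word_eval (free_group S2) f w \<in> normal_closure (free_group S2) E2"
    and g_relator: "\<And>w. w \<in> E2 \<Longrightarrow>
      word_eval (free_group S1) g w \<in> normal_closure (free_group S1) E1"
    and retract: "\<And>s. s \<in> S1 \<Longrightarrow>
      inv\<^bsub>free_group S1\<^esub> [(s, True)] \<otimes>\<^bsub>free_group S1\<^esub> word_eval (free_group S1) g (f s)
        \<in> normal_closure (free_group S1) E1"

lemma presentation_retract_of_iso:
  assumes fin: "finite S1" "finite S2"
    and E1: "E1 \<subseteq> carrier (free_group S1)" and E2: "E2 \<subseteq> carrier (free_group S2)"
    and iso: "presented_group S1 E1 \<cong> presented_group S2 E2"
  obtains f g where "presentation_retract S1 E1 S2 E2 f g"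
proof -
  let ?F1 = "free_group S1" and ?F2 = "free_group S2"
  let ?N1 = "normal_closure ?F1 E1" and ?N2 = "normal_closure ?F2 E2"
  interpret F1: group ?F1 by (rule group_free_group)
  interpret F2: group ?F2 by (rule group_free_group)
  interpret N1: normal ?N1 ?F1 by (rule F1.normal_normal_closure[OF E1])
  interpret N2: normal ?N2 ?F2 by (rule F2.normal_normal_closure[OF E2])
  interpret P1: group "presented_group S1 E1" by (rule group_presented_group[OF E1])
  interpret P2: group "presented_group S2 E2" by (rule group_presented_group[OF E2])
  obtain h where h: "h \<in> Group.iso (presented_group S1 E1) (presented_group S2 E2)"
    using iso unfolding is_iso_def by blast
  \<comment> \<open>\<open>k\<close> is the inverse isomorphism. The lifts of \<open>h\<close> and
    \<open>k\<close> are chosen independently, so they are inverse to each other only modulo the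
    relators.\<close>
  define k where "k = inv_into (carrier (presented_group S1 E1)) h"
  have hh: "h \<in> hom (presented_group S1 E1) (presented_group S2 E2)"
    using h by (rule iso_imp_homomorphism)
  have kh: "k \<in> hom (presented_group S2 E2) (presented_group S1 E1)"
    unfolding k_def by (rule iso_imp_homomorphism[OF P1.iso_set_sym[OF h]])
  have hk: "k (h X) = X" if "X \<in> carrier (presented_group S1 E1)" for X
    using h that unfolding k_def iso_iff by simp
  obtain f where f: "f \<in> S1 \<rightarrow> carrier ?F2"
    and fq: "\<And>w. w \<in> carrier ?F1 \<Longrightarrow> ?N2 #>\<^bsub>?F2\<^esub> word_eval ?F2 f w = h (?N1 #>\<^bsub>?F1\<^esub> w)"
    using presented_group_hom_lift[OF E1 E2 hh] by blast
  obtain g where g: "g \<in> S2 \<rightarrow> carrier ?F1"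
    and gq: "\<And>w. w \<in> carrier ?F2 \<Longrightarrow> ?N1 #>\<^bsub>?F1\<^esub> word_eval ?F1 g w = k (?N2 #>\<^bsub>?F2\<^esub> w)"
    using presented_group_hom_lift[OF E2 E1 kh] by blast
  note fhom = word_eval_hom[OF F2.group_axioms f]
  note ghom = word_eval_hom[OF F1.group_axioms g]
  have one: "\<one>\<^bsub>presented_group S1 E1\<^esub> = ?N1" "\<one>\<^bsub>presented_group S2 E2\<^esub> = ?N2"
    by (simp_all add: presented_group_def)
  have h1: "h ?N1 = ?N2"
    using hom_one[OF hh P1.group_axioms P2.group_axioms] by (simp add: one)
  have k1: "k ?N2 = ?N1"
    using hom_one[OF kh P2.group_axioms P1.group_axioms] by (simp add: one)
  have "presentation_retract S1 E1 S2 E2 f g"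
  proof (rule presentation_retract.intro[OF fin E1 E2 f g])
    fix w assume w: "w \<in> E1"
    then have "w \<in> carrier ?F1" "w \<in> ?N1" using E1 subset_normal_closure[of E1 ?F1] by auto
    then have "?N2 #>\<^bsub>?F2\<^esub> word_eval ?F2 f w = ?N2"
      using fq N1.rcos_const[OF F1.group_axioms] h1 by simp
    then show "word_eval ?F2 f w \<in> ?N2"
      using F2.coset_join1 hom_in_carrier[OF fhom] \<open>w \<in> carrier ?F1\<close> N2.subgroup_axioms by blast
  next
    fix w assume w: "w \<in> E2"
    then have "w \<in> carrier ?F2" "w \<in> ?N2" using E2 subset_normal_closure[of E2 ?F2] by auto
    then have "?N1 #>\<^bsub>?F1\<^esub> word_eval ?F1 g w = ?N1"
      using gq N2.rcos_const[OF F2.group_axioms] k1 by simp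
    then show "word_eval ?F1 g w \<in> ?N1"
      using F1.coset_join1 hom_in_carrier[OF ghom] \<open>w \<in> carrier ?F2\<close> N1.subgroup_axioms by blast
  next
    fix s assume s: "s \<in> S1"
    let ?s = "[(s, True)]" and ?v = "word_eval ?F1 g (f s)"
    have sc: "?s \<in> carrier ?F1" using s by (simp add: free_group_def)
    have fs: "f s \<in> carrier ?F2" using f s by blast
    have v: "?v \<in> carrier ?F1" using hom_in_carrier[OF ghom fs] .
    have "?N1 #>\<^bsub>?F1\<^esub> ?v = k (h (?N1 #>\<^bsub>?F1\<^esub> ?s))"
      using gq[OF fs] fq[OF sc] word_eval_generator[OF F2.group_axioms f s] by simp
    also have "\<dots> = ?N1 #>\<^bsub>?F1\<^esub> ?s"
      by (rule hk) (use sc in \<open>auto simp: presented_group_def carrier_FactGroup\<close>)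
    finally have "?v \<in> ?N1 #>\<^bsub>?F1\<^esub> ?s"
      using F1.rcos_self[OF v N1.subgroup_axioms] by simp
    \<comment> \<open>Normality turns the right coset into a left one, so that the inverse generator
      can be cancelled from the left, as \<open>retract\<close> requires.\<close>
    then have "?v \<in> ?s <#\<^bsub>?F1\<^esub> ?N1" using N1.coset_eq sc by simp
    then obtain n where n: "n \<in> ?N1" "?v = ?s \<otimes>\<^bsub>?F1\<^esub> n" unfolding l_coset_def by blast
    then have "inv\<^bsub>?F1\<^esub> ?s \<otimes>\<^bsub>?F1\<^esub> ?v = n"
      using sc N1.mem_carrier by (simp add: F1.m_assoc[symmetric])
    then show "inv\<^bsub>?F1\<^esub> ?s \<otimes>\<^bsub>?F1\<^esub> ?v \<in> ?N1" using n by simp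
  qed
  then show ?thesis by (rule that)
qed

section \<open>The Hamming distance\<close>

lemma perm_dist_nonneg: "0 \<le> perm_dist n p q"
  by (simp add: perm_dist_def)

lemma perm_dist_self [simp]: "perm_dist n p p = 0"
  by (simp add: perm_dist_def)

lemma perm_dist_le_1: "perm_dist n p q \<le> 1"
proof -
  have "card {x \<in> {1..n}. p x \<noteq> q x} \<le> card {1..n}" by (intro card_mono) auto
  then show ?thesis by (auto simp: perm_dist_def divide_le_eq_1)
qed

lemma perm_dist_commute: "perm_dist n p q = perm_dist n q p"
  unfolding perm_dist_def by (metis (no_types, lifting))

lemma perm_dist_triangle: "perm_dist n p r \<le> perm_dist n p q + perm_dist n q r"
proof -
  have "card {x \<in> {1..n}. p x \<noteq> r x}
      \<le> card ({x \<in> {1..n}. p x \<noteq> q x} \<union> {x \<in> {1..n}. q x \<noteq> r x})"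
    by (intro card_mono) auto
  also have "\<dots> \<le> card {x \<in> {1..n}. p x \<noteq> q x} + card {x \<in> {1..n}. q x \<noteq> r x}"
    by (rule card_Un_le)
  finally show ?thesis
    unfolding perm_dist_def add_divide_distrib[symmetric]
    by (intro divide_right_mono) auto
qed

lemma perm_dist_comp_left:
  assumes "inj a"
  shows "perm_dist n (a \<circ> p) (a \<circ> q) = perm_dist n p q"
  by (simp add: perm_dist_def inj_eq[OF assms])

lemma perm_dist_comp_right:
  assumes "b permutes {1..n}"
  shows "perm_dist n (p \<circ> b) (q \<circ> b) = perm_dist n p q"
proof -
  have "b ` {x \<in> {1..n}. p (b x) \<noteq> q (b x)} = {x \<in> {1..n}. p x \<noteq> q x}" (is "b ` ?A = ?B")
  proof
    show "b ` ?A \<subseteq> ?B" using permutes_in_image[OF assms] by auto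
    show "?B \<subseteq> b ` ?A"
    proof
      fix y assume y: "y \<in> ?B"
      then obtain x where "x \<in> {1..n}" "y = b x"
        using permutes_image[OF assms] by (metis (no_types, lifting) imageE mem_Collect_eq)
      with y show "y \<in> b ` ?A" by auto
    qed
  qed
  moreover have "card (b ` ?A) = card ?A"
    by (rule card_image[OF permutes_inj_on[OF assms]])
  ultimately show ?thesis by (simp add: perm_dist_def)
qed

text \<open>The intermediate map is \<open>p' \<circ> q\<close>. Only \<open>q\<close> has to
  preserve \<open>{1..n}\<close>, while \<open>p'\<close> merely has to be injective, so the primed
  maps may be permutations of larger degree.\<close>

lemma perm_dist_comp:
  assumes "inj p'" and "q permutes {1..n}"
  shows "perm_dist n (p \<circ> q) (p' \<circ> q') \<le> perm_dist n p p' + perm_dist n q q'"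
proof -
  have "perm_dist n (p \<circ> q) (p' \<circ> q') \<le> perm_dist n (p \<circ> q) (p' \<circ> q) + perm_dist n (p' \<circ> q) (p' \<circ> q')"
    by (rule perm_dist_triangle)
  then show ?thesis
    by (simp only: perm_dist_comp_left[OF assms(1)] perm_dist_comp_right[OF assms(2)])
qed

text \<open>Composing both inverses with \<open>p\<close> on the right and \<open>q\<close> on the
  left yields \<open>q\<close> and \<open>p\<close>. Bijectivity is all that is asked of
  \<open>q\<close>, so its degree may be larger.\<close>

lemma perm_dist_inv:
  assumes p: "p permutes {1..n}" and q: "bij q"
  shows "perm_dist n (inv' p) (inv' q) = perm_dist n p q"
proof -
  have "perm_dist n (inv' p) (inv' q) = perm_dist n (q \<circ> (inv' p \<circ> p)) (q \<circ> (inv' q \<circ> p))"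
    by (simp add: perm_dist_comp_left[OF bij_is_inj[OF q]] perm_dist_comp_right[OF p])
  also have "\<dots> = perm_dist n q p"
    using permutes_inv_o(2)[OF p] surj_iff[THEN iffD1, OF bij_is_surj[OF q]]
    by (simp add: comp_assoc[symmetric])
  finally show ?thesis by (simp add: perm_dist_commute)
qed

section \<open>Evaluating words on tuples of permutations\<close>

lemma sym_tuplesD: "\<sigma> \<in> sym_tuples S n \<Longrightarrow> \<sigma> \<in> S \<rightarrow> carrier (sym_group n)"
  unfolding sym_tuples_def by auto

lemma sym_tuples_permutes: "\<sigma> \<in> sym_tuples S n \<Longrightarrow> s \<in> S \<Longrightarrow> \<sigma> s permutes {1..n}"
  unfolding sym_tuples_def by (auto simp: sym_group_carrier)

lemma word_eval_permutes:
  "\<sigma> \<in> sym_tuples S n \<Longrightarrow> set w \<subseteq> S \<times> UNIV \<Longrightarrow> word_eval (sym_group n) \<sigma> w permutes {1..n}"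
  using word_eval_closed[OF sym_group_is_group sym_tuplesD] by (auto simp: sym_group_carrier)

text \<open>A letter on which the two tuples agree at the current point of the orbit keeps the two
  trajectories together; since the first trajectory stays in \<open>{1..n}\<close>, it does not matter that the
  second tuple acts on the larger set \<open>{1..N}\<close>.\<close>

lemma perm_dist_word_eval:
  assumes fin: "finite S" and \<sigma>: "\<sigma> \<in> sym_tuples S n" and \<tau>: "\<tau> \<in> sym_tuples S N"
    and "set w \<subseteq> S \<times> UNIV"
  shows "perm_dist n (word_eval (sym_group n) \<sigma> w) (word_eval (sym_group N) \<tau> w)
    \<le> length w * (\<Sum>s\<in>S. perm_dist n (\<sigma> s) (\<tau> s))"
  using \<open>set w \<subseteq> S \<times> UNIV\<close>
proof (induction w)
  case Nil
  then show ?case by (simp add: word_eval_simps sym_group_one)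
next
  case (Cons x w)
  let ?D = "\<Sum>s\<in>S. perm_dist n (\<sigma> s) (\<tau> s)"
  obtain s b where x: "x = (s, b)" by fastforce
  with Cons.prems have s: "s \<in> S" and w: "set w \<subseteq> S \<times> UNIV" by auto
  define p where "p = (if b then \<sigma> s else inv' (\<sigma> s))"
  define q where "q = (if b then \<tau> s else inv' (\<tau> s))"
  note \<sigma>s = sym_tuples_permutes[OF \<sigma> s] and \<tau>s = sym_tuples_permutes[OF \<tau> s]
  have "inj q"
    unfolding q_def using permutes_inj[OF \<tau>s] permutes_inj[OF permutes_inv[OF \<tau>s]] by simp
  have "perm_dist n p q = perm_dist n (\<sigma> s) (\<tau> s)"
    unfolding p_def q_def using perm_dist_inv[OF \<sigma>s permutes_bij[OF \<tau>s]] by simp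
  also have "\<dots> \<le> ?D"
    using s fin by (intro member_le_sum) (auto simp: perm_dist_nonneg)
  finally have pq: "perm_dist n p q \<le> ?D" .
  have "word_eval (sym_group n) \<sigma> (x # w) = p \<circ> word_eval (sym_group n) \<sigma> w"
    using \<sigma>s by (simp add: word_eval_simps x p_def sym_group_mult sym_group_carrier)
  moreover have "word_eval (sym_group N) \<tau> (x # w) = q \<circ> word_eval (sym_group N) \<tau> w"
    using \<tau>s by (simp add: word_eval_simps x q_def sym_group_mult sym_group_carrier)
  ultimately have "perm_dist n (word_eval (sym_group n) \<sigma> (x # w)) (word_eval (sym_group N) \<tau> (x # w))
      \<le> perm_dist n p q
        + perm_dist n (word_eval (sym_group n) \<sigma> w) (word_eval (sym_group N) \<tau> w)"
    using perm_dist_comp[OF \<open>inj q\<close> word_eval_permutes[OF \<sigma> w]] by simp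
  also have "\<dots> \<le> ?D + length w * ?D"
    using pq Cons.IH[OF w] by simp
  finally show ?case by (simp add: algebra_simps)
qed

section \<open>Pullback of tuples along homomorphisms of free groups\<close>

text \<open>A tuple amounts to a homomorphism from a free group to Sym(n); this is its composite
  with the homomorphism given by \<open>h\<close>, as \<open>word_eval_substitute\<close> confirms.
  Restricting to \<open>T\<close> provides the extensionality that \<open>sym_tuples\<close>
  demands.\<close>

definition substitute ::
  "'b set \<Rightarrow> nat \<Rightarrow> ('b \<Rightarrow> 'a fword) \<Rightarrow> ('a \<Rightarrow> nat \<Rightarrow> nat) \<Rightarrow> 'b \<Rightarrow> nat \<Rightarrow> nat" where
  "substitute T n h \<sigma> = (\<lambda>t\<in>T. word_eval (sym_group n) \<sigma> (h t))"

lemma free_group_carrier_set: "w \<in> carrier (free_group S) \<Longrightarrow> set w \<subseteq> S \<times> UNIV"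
  by (simp add: free_group_def)

lemma substitute_sym_tuples:
  assumes "h \<in> T \<rightarrow> carrier (free_group S)" and "\<sigma> \<in> sym_tuples S n"
  shows "substitute T n h \<sigma> \<in> sym_tuples T n"
  using assms word_eval_closed[OF sym_group_is_group sym_tuplesD[OF assms(2)]]
  unfolding sym_tuples_def substitute_def by (auto dest!: funcset_mem free_group_carrier_set)

text \<open>Both sides are homomorphisms on \<open>free_group T\<close>, so agreement on generators
  suffices.\<close>

lemma word_eval_substitute:
  assumes h: "h \<in> T \<rightarrow> carrier (free_group S)" and \<sigma>: "\<sigma> \<in> sym_tuples S n"
    and w: "w \<in> carrier (free_group T)"
  shows "word_eval (sym_group n) (substitute T n h \<sigma>) w
    = word_eval (sym_group n) \<sigma> (word_eval (free_group S) h w)"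
proof -
  have "word_eval (sym_group n) \<sigma> \<circ> word_eval (free_group S) h \<in> hom (free_group T) (sym_group n)"
    by (rule hom_compose[OF word_eval_hom[OF group_free_group h]
          word_eval_hom[OF sym_group_is_group sym_tuplesD[OF \<sigma>]]])
  from word_eval_unique[OF sym_group_is_group sym_tuplesD[OF substitute_sym_tuples[OF h \<sigma>]] this _ w]
  show ?thesis
    by (simp add: word_eval_generator[OF group_free_group h] substitute_def)
qed

text \<open>The kernel of evaluation at \<sigma> is a normal subgroup containing
  \<open>E\<close>.\<close>

lemma sol_word_eval_normal_closure:
  assumes \<sigma>: "\<sigma> \<in> sol S E n" and E: "E \<subseteq> carrier (free_group S)"
    and w: "w \<in> normal_closure (free_group S) E"
  shows "word_eval (sym_group n) \<sigma> w = id"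
proof -
  have \<sigma>': "\<sigma> \<in> sym_tuples S n" using \<sigma> by (simp add: sol_def)
  interpret group_hom "free_group S" "sym_group n" "word_eval (sym_group n) \<sigma>"
    using word_eval_hom[OF sym_group_is_group sym_tuplesD[OF \<sigma>']]
    by (simp add: group_hom_def group_hom_axioms_def group_free_group sym_group_is_group)
  have "E \<subseteq> kernel (free_group S) (sym_group n) (word_eval (sym_group n) \<sigma>)"
    using \<sigma> E by (auto simp: kernel_def sol_def sym_group_one)
  with w show ?thesis
    using normal_closure_least[OF normal_kernel] by (auto simp: kernel_def sym_group_one)
qed

text \<open>Solutions are actions of the presented group. By \<open>rel\<close>, \<open>h\<close>
  descends to a homomorphism between presented groups, and actions pull back along it.\<close>

lemma substitute_sol:
  assumes h: "h \<in> T \<rightarrow> carrier (free_group S)" and \<sigma>: "\<sigma> \<in> sol S E n"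
    and E: "E \<subseteq> carrier (free_group S)" and E': "E' \<subseteq> carrier (free_group T)"
    and rel: "\<And>w. w \<in> E' \<Longrightarrow> word_eval (free_group S) h w \<in> normal_closure (free_group S) E"
  shows "substitute T n h \<sigma> \<in> sol T E' n"
proof -
  have \<sigma>': "\<sigma> \<in> sym_tuples S n" using \<sigma> by (simp add: sol_def)
  show ?thesis
    using E' word_eval_substitute[OF h \<sigma>'] sol_word_eval_normal_closure[OF \<sigma> E rel]
      substitute_sym_tuples[OF h \<sigma>']
    by (auto simp: sol_def)
qed

section \<open>Displacement bounds for words in the normal closure\<close>

text \<open>Quantitative form of being a consequence of \<open>E\<close>: a tuple that nearly
  satisfies \<open>E0\<close> nearly satisfies \<open>w\<close>. The order of quantifiers matters:
  \<open>E0\<close> and \<open>C\<close> are uniform in \<open>n\<close> and \<sigma>, and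
  \<open>E0\<close> is finite even if \<open>E\<close> is not.\<close>

definition controlled :: "'a set \<Rightarrow> 'a fword set \<Rightarrow> 'a fword \<Rightarrow> bool" where
  "controlled S E w \<longleftrightarrow> (\<exists>E0 C. finite E0 \<and> E0 \<subseteq> E \<and> 0 \<le> C \<and>
     (\<forall>n. \<forall>\<sigma>\<in>sym_tuples S n. perm_dist n (word_eval (sym_group n) \<sigma> w) id
        \<le> C * (\<Sum>e\<in>E0. perm_dist n (word_eval (sym_group n) \<sigma> e) id)))"

lemma controlled_le:
  assumes "controlled S E v"
    and "\<And>n \<sigma>. \<sigma> \<in> sym_tuples S n \<Longrightarrow> perm_dist n (word_eval (sym_group n) \<sigma> w) id
      \<le> perm_dist n (word_eval (sym_group n) \<sigma> v) id"
  shows "controlled S E w"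
  using assms unfolding controlled_def by (meson order_trans)

lemma controlled_add:
  assumes "controlled S E u" "controlled S E v"
    and w: "\<And>n \<sigma>. \<sigma> \<in> sym_tuples S n \<Longrightarrow> perm_dist n (word_eval (sym_group n) \<sigma> w) id
      \<le> perm_dist n (word_eval (sym_group n) \<sigma> u) id + perm_dist n (word_eval (sym_group n) \<sigma> v) id"
  shows "controlled S E w"
proof -
  obtain A C where A: "finite A" "A \<subseteq> E" "0 \<le> C"
    "\<And>n \<sigma>. \<sigma> \<in> sym_tuples S n \<Longrightarrow> perm_dist n (word_eval (sym_group n) \<sigma> u) id
        \<le> C * (\<Sum>e\<in>A. perm_dist n (word_eval (sym_group n) \<sigma> e) id)"
    using assms(1) unfolding controlled_def by blast
  obtain B D where B: "finite B" "B \<subseteq> E" "0 \<le> D"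
    "\<And>n \<sigma>. \<sigma> \<in> sym_tuples S n \<Longrightarrow> perm_dist n (word_eval (sym_group n) \<sigma> v) id
        \<le> D * (\<Sum>e\<in>B. perm_dist n (word_eval (sym_group n) \<sigma> e) id)"
    using assms(2) unfolding controlled_def by blast
  have "perm_dist n (word_eval (sym_group n) \<sigma> w) id
      \<le> (C + D) * (\<Sum>e\<in>A \<union> B. perm_dist n (word_eval (sym_group n) \<sigma> e) id)" (is "_ \<le> _ * ?m (A \<union> B)")
    if \<sigma>: "\<sigma> \<in> sym_tuples S n" for n \<sigma>
  proof -
    have "?m A \<le> ?m (A \<union> B)" "?m B \<le> ?m (A \<union> B)"
      using A(1) B(1) by (auto intro!: sum_mono2 simp: perm_dist_nonneg)
    then have "C * ?m A + D * ?m B \<le> C * ?m (A \<union> B) + D * ?m (A \<union> B)"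
      using A(3) B(3) by (intro add_mono mult_left_mono)
    then show ?thesis
      using w[OF \<sigma>] A(4)[OF \<sigma>] B(4)[OF \<sigma>] unfolding distrib_right by linarith
  qed
  then show ?thesis unfolding controlled_def
    using A B by (intro exI[of _ "A \<union> B"] exI[of _ "C + D"]) auto
qed

text \<open>The controlled words form a normal subgroup containing \<open>E\<close>: products are
  handled by the triangle inequality, inverses and conjugates by the invariance of the Hamming
  distance under composition on either side.\<close>

lemma normal_closure_controlled:
  assumes E: "E \<subseteq> carrier (free_group S)" and w: "w \<in> normal_closure (free_group S) E"
  shows "controlled S E w"
proof -
  let ?F = "free_group S"
  interpret F: group ?F by (rule group_free_group)
  let ?ev = "\<lambda>n. word_eval (sym_group n)"
  let ?N = "{w \<in> carrier ?F. controlled S E w}"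
  have hom: "?ev n \<sigma> \<in> hom ?F (sym_group n)" if "\<sigma> \<in> sym_tuples S n" for n \<sigma>
    by (rule word_eval_hom[OF sym_group_is_group sym_tuplesD[OF that]])
  have perm: "?ev n \<sigma> u permutes {1..n}" if "\<sigma> \<in> sym_tuples S n" "u \<in> carrier ?F" for n \<sigma> u
    using hom_in_carrier[OF hom[OF that(1)] that(2)] by (simp add: sym_group_carrier)
  have mult: "?ev n \<sigma> (u \<otimes>\<^bsub>?F\<^esub> v) = ?ev n \<sigma> u \<circ> ?ev n \<sigma> v"
    if "\<sigma> \<in> sym_tuples S n" "u \<in> carrier ?F" "v \<in> carrier ?F" for n \<sigma> u v
    using hom_mult[OF hom[OF that(1)] that(2,3)] by (simp add: sym_group_mult)
  have inv: "?ev n \<sigma> (inv\<^bsub>?F\<^esub> u) = inv' (?ev n \<sigma> u)"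
    if "\<sigma> \<in> sym_tuples S n" "u \<in> carrier ?F" for n \<sigma> u
  proof -
    interpret group_hom ?F "sym_group n" "?ev n \<sigma>"
      using hom[OF that(1)]
      by (simp add: group_hom_def group_hom_axioms_def group_free_group sym_group_is_group)
    show ?thesis using that perm[OF that] by (simp add: sym_group_carrier)
  qed
  have "controlled S E \<one>\<^bsub>?F\<^esub>"
    unfolding controlled_def
    by (rule exI[of _ "{}"]) (auto simp: free_group_def word_eval_simps sym_group_one)
  moreover have "controlled S E (inv\<^bsub>?F\<^esub> u)" if "u \<in> ?N" for u
  proof (rule controlled_le)
    show "controlled S E u" using that by simp
    fix n \<sigma> assume \<sigma>: "\<sigma> \<in> sym_tuples S n"
    show "perm_dist n (?ev n \<sigma> (inv\<^bsub>?F\<^esub> u)) id \<le> perm_dist n (?ev n \<sigma> u) id"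
      using that perm_dist_inv[OF perm[OF \<sigma>] bij_id] by (simp add: inv[OF \<sigma>])
  qed
  moreover have "controlled S E (u \<otimes>\<^bsub>?F\<^esub> v)" if "u \<in> ?N" "v \<in> ?N" for u v
  proof (rule controlled_add)
    show "controlled S E u" "controlled S E v" using that by auto
    fix n \<sigma> assume \<sigma>: "\<sigma> \<in> sym_tuples S n"
    show "perm_dist n (?ev n \<sigma> (u \<otimes>\<^bsub>?F\<^esub> v)) id
        \<le> perm_dist n (?ev n \<sigma> u) id + perm_dist n (?ev n \<sigma> v) id"
      using that perm_dist_comp[OF inj_on_id perm[OF \<sigma>], of v "?ev n \<sigma> u" id]
      by (simp add: mult[OF \<sigma>])
  qed
  moreover have "controlled S E (x \<otimes>\<^bsub>?F\<^esub> u \<otimes>\<^bsub>?F\<^esub> inv\<^bsub>?F\<^esub> x)"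
    if u: "u \<in> ?N" and x: "x \<in> carrier ?F" for u x
  proof (rule controlled_le)
    show "controlled S E u" using u by simp
    fix n \<sigma> assume \<sigma>: "\<sigma> \<in> sym_tuples S n"
    let ?x = "?ev n \<sigma> x" and ?u = "?ev n \<sigma> u"
    note px = perm[OF \<sigma> x]
    have "?ev n \<sigma> (x \<otimes>\<^bsub>?F\<^esub> u \<otimes>\<^bsub>?F\<^esub> inv\<^bsub>?F\<^esub> x) = ?x \<circ> ?u \<circ> inv' ?x"
      using u x by (simp add: mult[OF \<sigma>] inv[OF \<sigma>])
    \<comment> \<open>Writing the identity as a conjugate too lets the outer factors be removed from
      both arguments of the distance.\<close>
    moreover have "id = ?x \<circ> id \<circ> inv' ?x" using permutes_inv_o(1)[OF px] by simp
    ultimately have "perm_dist n (?ev n \<sigma> (x \<otimes>\<^bsub>?F\<^esub> u \<otimes>\<^bsub>?F\<^esub> inv\<^bsub>?F\<^esub> x)) id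
        = perm_dist n (?x \<circ> ?u \<circ> inv' ?x) (?x \<circ> id \<circ> inv' ?x)"
      by metis
    also have "\<dots> = perm_dist n ?u id"
      by (simp only: perm_dist_comp_right[OF permutes_inv[OF px]]
          perm_dist_comp_left[OF permutes_inj[OF px]])
    finally show "perm_dist n (?ev n \<sigma> (x \<otimes>\<^bsub>?F\<^esub> u \<otimes>\<^bsub>?F\<^esub> inv\<^bsub>?F\<^esub> x)) id \<le> perm_dist n ?u id"
      by simp
  qed
  ultimately have "?N \<lhd> ?F"
    unfolding F.normal_inv_iff by (auto intro!: F.subgroupI)
  moreover have "E \<subseteq> ?N"
  proof
    fix e assume "e \<in> E"
    then show "e \<in> ?N"
      using E by (auto simp: controlled_def intro!: exI[of _ "{e}"] exI[of _ 1])
  qed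
  ultimately show ?thesis using normal_closure_least w by blast
qed

text \<open>Taking unions of the sets and adding the constants gives one bound for all words of
  \<open>Q\<close>. The constant is made strictly positive so that it can later be divided
  by.\<close>

lemma finite_controlled:
  assumes "finite Q" and "\<And>w. w \<in> Q \<Longrightarrow> controlled S E w"
  shows "\<exists>E0 C. finite E0 \<and> E0 \<subseteq> E \<and> 0 < (C :: real) \<and>
    (\<forall>w\<in>Q. \<forall>n. \<forall>\<sigma>\<in>sym_tuples S n. perm_dist n (word_eval (sym_group n) \<sigma> w) id
        \<le> C * (\<Sum>e\<in>E0. perm_dist n (word_eval (sym_group n) \<sigma> e) id))"
  using assms
proof (induction Q)
  case empty
  then show ?case by (intro exI[of _ "{}"] exI[of _ 1]) auto
next
  case (insert w Q)
  have Qc: "controlled S E v" if "v \<in> Q" for v using insert.prems that by blast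
  let ?m = "\<lambda>n \<sigma> A. \<Sum>e\<in>A. perm_dist n (word_eval (sym_group n) \<sigma> e) id"
  obtain A C where A: "finite A" "A \<subseteq> E" "0 < C"
    "\<And>v n \<sigma>. v \<in> Q \<Longrightarrow> \<sigma> \<in> sym_tuples S n \<Longrightarrow>
      perm_dist n (word_eval (sym_group n) \<sigma> v) id \<le> C * ?m n \<sigma> A"
    using insert.IH[OF Qc] by blast
  obtain B D where B: "finite B" "B \<subseteq> E" "0 \<le> D"
    "\<And>n \<sigma>. \<sigma> \<in> sym_tuples S n \<Longrightarrow> perm_dist n (word_eval (sym_group n) \<sigma> w) id \<le> D * ?m n \<sigma> B"
    using insert.prems[OF insertI1] unfolding controlled_def by blast
  have "perm_dist n (word_eval (sym_group n) \<sigma> v) id \<le> (C + D) * ?m n \<sigma> (A \<union> B)"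
    if v: "v \<in> insert w Q" and \<sigma>: "\<sigma> \<in> sym_tuples S n" for v n \<sigma>
  proof -
    have "?m n \<sigma> A \<le> ?m n \<sigma> (A \<union> B)" "?m n \<sigma> B \<le> ?m n \<sigma> (A \<union> B)" "0 \<le> ?m n \<sigma> A" "0 \<le> ?m n \<sigma> B"
      using A(1) B(1) by (auto intro!: sum_mono2 sum_nonneg simp: perm_dist_nonneg)
    then have "C * ?m n \<sigma> A \<le> (C + D) * ?m n \<sigma> (A \<union> B)" "D * ?m n \<sigma> B \<le> (C + D) * ?m n \<sigma> (A \<union> B)"
      using A(3) B(3) by (auto intro!: mult_mono)
    then show ?thesis using v A(4)[OF _ \<sigma>, of v] B(4)[OF \<sigma>] by auto
  qed
  moreover have "finite (A \<union> B)" "A \<union> B \<subseteq> E" "0 < C + D" using A(1-3) B(1-3) by auto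
  ultimately show ?case by blast
qed

section \<open>Transfer of far tuples\<close>

context presentation_retract
begin

text \<open>Measures how far the double pullback along \<open>g\<close> and \<open>f\<close> is from
  returning the original tuple in coordinate \<open>s\<close>; see
  \<open>perm_dist_retract_relator\<close>.\<close>

definition retract_relator :: "'a \<Rightarrow> 'a fword" where
  "retract_relator s =
     inv\<^bsub>free_group S1\<^esub> [(s, True)] \<otimes>\<^bsub>free_group S1\<^esub> word_eval (free_group S1) g (f s)"

lemma retract_relator_closed: "s \<in> S1 \<Longrightarrow> retract_relator s \<in> carrier (free_group S1)"
proof -
  assume s: "s \<in> S1"
  interpret F1: group "free_group S1" by (rule group_free_group)
  show ?thesis
    unfolding retract_relator_def
  proof (intro F1.m_closed F1.inv_closed)
    show "[(s, True)] \<in> carrier (free_group S1)" using s by (simp add: free_group_def)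
    show "word_eval (free_group S1) g (f s) \<in> carrier (free_group S1)"
      using s f by (blast intro: hom_in_carrier[OF word_eval_hom[OF group_free_group g]])
  qed
qed

text \<open>Composing with \<open>\<sigma> s\<close> on the left preserves distances, cancels the
  inverse generator in the relator, and turns the identity into \<open>\<sigma> s\<close>.\<close>

lemma perm_dist_retract_relator:
  assumes s: "s \<in> S1" and \<sigma>: "\<sigma> \<in> sym_tuples S1 n"
  shows "perm_dist n (word_eval (sym_group n) \<sigma> (retract_relator s)) id
    = perm_dist n (\<sigma> s) (word_eval (sym_group n) (substitute S2 n g \<sigma>) (f s))"
proof -
  let ?F1 = "free_group S1" and ?ev = "word_eval (sym_group n) \<sigma>"
  interpret group_hom ?F1 "sym_group n" ?ev
    using word_eval_hom[OF sym_group_is_group sym_tuplesD[OF \<sigma>]]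
    by (simp add: group_hom_def group_hom_axioms_def group_free_group sym_group_is_group)
  have sc: "[(s, True)] \<in> carrier ?F1" using s by (simp add: free_group_def)
  have fs: "f s \<in> carrier (free_group S2)" using f s by blast
  have v: "word_eval ?F1 g (f s) \<in> carrier ?F1"
    using hom_in_carrier[OF word_eval_hom[OF group_free_group g] fs] .
  note \<sigma>s = sym_tuples_permutes[OF \<sigma> s]
  have "?ev (retract_relator s) = inv' (\<sigma> s) \<circ> ?ev (word_eval ?F1 g (f s))"
    unfolding retract_relator_def
    using sc v \<sigma>s word_eval_generator[OF sym_group_is_group sym_tuplesD[OF \<sigma>] s]
    by (simp add: sym_group_mult sym_group_carrier)
  then have "\<sigma> s \<circ> ?ev (retract_relator s) = ?ev (word_eval ?F1 g (f s))"
    using permutes_inv_o(1)[OF \<sigma>s] by (simp add: comp_assoc[symmetric])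
  then show ?thesis
    using perm_dist_comp_left[OF permutes_inj[OF \<sigma>s], of n "?ev (retract_relator s)" id]
    by (simp add: word_eval_substitute[OF g \<sigma> fs] perm_dist_commute)
qed

text \<open>Contrapositive: let the pullback of \<sigma> be near a solution \<tau> of
  \<open>E2\<close>, and let every retraction relator have displacement below \<eta>. Then the
  pullback of \<tau> along \<open>f\<close> solves \<open>E1\<close> in the same degree as \<tau>
  and is near \<sigma>, with the double pullback of \<sigma> as intermediate tuple.\<close>

lemma substitute_far_or_retract_relator_moves:
  fixes \<nu> :: "real \<Rightarrow> nat \<Rightarrow> enat"
  assumes mono: "\<And>n. n \<ge> 1 \<Longrightarrow> mono_on {0<..} (\<lambda>\<epsilon>. \<nu> \<epsilon> n)" and \<epsilon>: "\<epsilon> > 0"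
  obtains \<epsilon>' \<eta> where "\<epsilon>' > 0" "\<eta> > 0"
    "\<And>n \<sigma>. n \<ge> 1 \<Longrightarrow> \<sigma> \<in> sol_far S1 E1 \<nu> \<epsilon> n \<Longrightarrow>
      substitute S2 n g \<sigma> \<notin> sol_far S2 E2 \<nu> \<epsilon>' n \<Longrightarrow>
      \<exists>s\<in>S1. \<eta> \<le> perm_dist n (word_eval (sym_group n) \<sigma> (retract_relator s)) id"
proof -
  \<comment> \<open>Half of \<epsilon> pays for the distance to \<tau>, which substitution of all
    the words \<open>f s\<close> multiplies by at most \<open>L\<close> in total; the other half
    pays for the retraction relators, \<eta> for each generator. The \<open>+ 1\<close> avoids
    division by zero and makes both estimates strict.\<close>
  define L where "L = (\<Sum>s\<in>S1. length (f s))"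
  define \<epsilon>' where "\<epsilon>' = \<epsilon> / (2 * (real L + 1))"
  define \<eta> where "\<eta> = \<epsilon> / (2 * (real (card S1) + 1))"
  have \<epsilon>': "0 < \<epsilon>'" "\<epsilon>' \<le> \<epsilon>" and \<eta>: "0 < \<eta>"
    using \<epsilon> by (auto simp: \<epsilon>'_def \<eta>_def field_simps)
  have L: "real L * \<epsilon>' < \<epsilon> / 2" and k: "real (card S1) * \<eta> < \<epsilon> / 2"
    using \<epsilon> by (auto simp: \<epsilon>'_def \<eta>_def field_simps)
  have "\<exists>s\<in>S1. \<eta> \<le> perm_dist n (word_eval (sym_group n) \<sigma> (retract_relator s)) id"
    if n: "n \<ge> 1" and far: "\<sigma> \<in> sol_far S1 E1 \<nu> \<epsilon> n"
      and near: "substitute S2 n g \<sigma> \<notin> sol_far S2 E2 \<nu> \<epsilon>' n" for n \<sigma>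
  proof (rule ccontr)
    assume contr: "\<not> ?thesis"
    let ?\<rho> = "substitute S2 n g \<sigma>"
    have \<sigma>: "\<sigma> \<in> sym_tuples S1 n" using far by (simp add: sol_far_def)
    have \<rho>: "?\<rho> \<in> sym_tuples S2 n" by (rule substitute_sym_tuples[OF g \<sigma>])
    with near have "?\<rho> \<in> sol_near S2 E2 \<nu> \<epsilon>' n" by (simp add: sol_far_def)
    then obtain N \<tau> where N: "n \<le> N" "enat N \<le> enat n + \<nu> \<epsilon>' n" and \<tau>: "\<tau> \<in> sol S2 E2 N"
      and d: "(\<Sum>t\<in>S2. perm_dist n (?\<rho> t) (\<tau> t)) < \<epsilon>'"
      unfolding sol_near_def by blast
    have \<tau>': "\<tau> \<in> sym_tuples S2 N" using \<tau> by (simp add: sol_def)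
    let ?\<tau> = "substitute S1 N f \<tau>"
    have sol: "?\<tau> \<in> sol S1 E1 N" by (rule substitute_sol[OF f \<tau> E2 E1 f_relator])
    have le: "perm_dist n (\<sigma> s) (?\<tau> s) \<le> \<eta> + length (f s) * \<epsilon>'" if s: "s \<in> S1" for s
    proof -
      have "set (f s) \<subseteq> S2 \<times> UNIV" using f s free_group_carrier_set by blast
      then have "perm_dist n (word_eval (sym_group n) ?\<rho> (f s)) (?\<tau> s)
          \<le> length (f s) * (\<Sum>t\<in>S2. perm_dist n (?\<rho> t) (\<tau> t))"
        using perm_dist_word_eval[OF finite_S2 \<rho> \<tau>'] s by (simp add: substitute_def)
      also have "\<dots> \<le> length (f s) * \<epsilon>'" using d by (intro mult_left_mono) auto
      finally have "perm_dist n (word_eval (sym_group n) ?\<rho> (f s)) (?\<tau> s) \<le> length (f s) * \<epsilon>'" .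
      moreover have "perm_dist n (\<sigma> s) (word_eval (sym_group n) ?\<rho> (f s)) \<le> \<eta>"
        using contr s perm_dist_retract_relator[OF s \<sigma>] by force
      ultimately show ?thesis
        using perm_dist_triangle[of n "\<sigma> s" "?\<tau> s" "word_eval (sym_group n) ?\<rho> (f s)"] by linarith
    qed
    have "(\<Sum>s\<in>S1. perm_dist n (\<sigma> s) (?\<tau> s)) \<le> (\<Sum>s\<in>S1. \<eta> + length (f s) * \<epsilon>')"
      by (intro sum_mono le)
    also have "\<dots> = card S1 * \<eta> + L * \<epsilon>'"
      by (simp add: sum.distrib L_def sum_distrib_right)
    also have "\<dots> < \<epsilon>" using L k by linarith
    finally have "(\<Sum>s\<in>S1. perm_dist n (\<sigma> s) (?\<tau> s)) < \<epsilon>" .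
    \<comment> \<open>The degree \<open>N\<close> was allowed for the smaller parameter \<epsilon>';
      monotonicity of \<nu> makes it allowed for \<epsilon>.\<close>
    moreover have "\<nu> \<epsilon>' n \<le> \<nu> \<epsilon> n"
      using mono_onD[OF mono[OF n]] \<epsilon>' \<epsilon> by auto
    then have "enat N \<le> enat n + \<nu> \<epsilon> n"
      using N(2) by (meson add_left_mono order_trans)
    ultimately have "\<sigma> \<in> sol_near S1 E1 \<nu> \<epsilon> n"
      using \<sigma> N(1) sol unfolding sol_near_def by blast
    with far show False by (simp add: sol_far_def)
  qed
  with \<epsilon>'(1) \<eta> show ?thesis by (rule that)
qed

end

section \<open>Flexible BS-rigidity\<close>

lemma tv_dist_eq_sum:
  assumes "finite A" "set_pmf p \<subseteq> A" "set_pmf q \<subseteq> A"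
  shows "tv_dist p q = (\<Sum>x\<in>A. \<bar>pmf p x - pmf q x\<bar>) / 2"
proof -
  have "pmf p x = 0 \<and> pmf q x = 0" if "x \<notin> A" for x
    using assms that by (auto simp: pmf_eq_0_set_pmf)
  then have "(\<Sum>\<^sub>\<infinity>x. \<bar>pmf p x - pmf q x\<bar>) = (\<Sum>\<^sub>\<infinity>x\<in>A. \<bar>pmf p x - pmf q x\<bar>)"
    by (intro infsum_cong_neutral) auto
  then show ?thesis using assms(1) by (simp add: tv_dist_def)
qed

text \<open>Data processing inequality: \<open>h\<close> merges the atoms within each fibre, and the
  triangle inequality applies fibre by fibre.\<close>

lemma tv_dist_map_le:
  assumes "finite (set_pmf p)" "finite (set_pmf q)"
  shows "tv_dist (map_pmf h p) (map_pmf h q) \<le> tv_dist p q"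
proof -
  define A where "A = set_pmf p \<union> set_pmf q"
  have A: "finite A" "set_pmf p \<subseteq> A" "set_pmf q \<subseteq> A" using assms by (auto simp: A_def)
  have *: "pmf (map_pmf h r) y = (\<Sum>x | x \<in> A \<and> h x = y. pmf r x)" if "set_pmf r \<subseteq> A" for r y
  proof -
    have "pmf (map_pmf h r) y = measure r {x \<in> A. h x = y}"
      unfolding pmf_map
      using that by (intro measure_prob_cong_0) (auto simp: pmf_eq_0_set_pmf subset_iff)
    then show ?thesis using A(1) by (simp add: measure_measure_pmf_finite)
  qed
  have "(\<Sum>y\<in>h ` A. \<bar>pmf (map_pmf h p) y - pmf (map_pmf h q) y\<bar>)
      = (\<Sum>y\<in>h ` A. \<bar>\<Sum>x | x \<in> A \<and> h x = y. pmf p x - pmf q x\<bar>)"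
    by (simp add: * A sum_subtractf)
  also have "\<dots> \<le> (\<Sum>y\<in>h ` A. \<Sum>x | x \<in> A \<and> h x = y. \<bar>pmf p x - pmf q x\<bar>)"
    by (intro sum_mono sum_abs)
  also have "\<dots> = (\<Sum>x\<in>A. \<bar>pmf p x - pmf q x\<bar>)"
    by (rule sum.image_gen[OF A(1), symmetric])
  finally show ?thesis
    using A tv_dist_eq_sum[OF A] tv_dist_eq_sum[of "h ` A" "map_pmf h p" "map_pmf h q"]
    by (simp add: image_mono)
qed

text \<open>The probabilities of \<open>False\<close> are complementary, so both summands are equal
  and the factor one half cancels.\<close>

lemma tv_dist_bool: "tv_dist p q = \<bar>pmf p True - pmf q True\<bar>"
  by (subst tv_dist_eq_sum[of UNIV]) (auto simp: UNIV_bool pmf_False_conv_True)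

section \<open>Displacement as seen by stabilizer statistics\<close>

lemma measure_fixed_points:
  assumes "n \<ge> 1"
  shows "measure (pmf_of_set {1..n}) {x. p x = x} = 1 - perm_dist n p id"
proof -
  have "{1..n} - {x \<in> {1..n}. p x \<noteq> x} = {1..n} \<inter> {x. p x = x}" by auto
  moreover have "card ({1..n} - {x \<in> {1..n}. p x \<noteq> x}) = n - card {x \<in> {1..n}. p x \<noteq> x}"
    by (subst card_Diff_subset) auto
  moreover have "card {x \<in> {1..n}. p x \<noteq> x} \<le> card {1..n}"
    by (intro card_mono) auto
  ultimately have "real (card ({1..n} \<inter> {x. p x = x})) = n - real (card {x \<in> {1..n}. p x \<noteq> x})"
    by (simp add: of_nat_diff)
  then show ?thesis using assms
    by (simp add: measure_pmf_of_set perm_dist_def field_simps)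
qed

lemma finite_set_stabilizer_pmf: "n \<ge> 1 \<Longrightarrow> finite (set_pmf (stabilizer_pmf n \<sigma> P))"
  by (simp add: stabilizer_pmf_def)

text \<open>Whether \<open>w\<close> fixes the random point is a function of the stabilizer pattern,
  so data processing applies. For \<tau> this event has probability 1, and for \<sigma> it fails
  with probability equal to the displacement.\<close>

lemma tv_dist_stabilizer_ge_perm_dist:
  assumes n: "n \<ge> 1" and w: "w \<in> P" and \<tau>: "word_eval (sym_group n) \<tau> w = id"
  shows "perm_dist n (word_eval (sym_group n) \<sigma> w) id
    \<le> tv_dist (stabilizer_pmf n \<sigma> P) (stabilizer_pmf n \<tau> P)"
proof -
  have *: "pmf (map_pmf (\<lambda>A. w \<in> A) (stabilizer_pmf n \<rho> P)) True
      = 1 - perm_dist n (word_eval (sym_group n) \<rho> w) id" for \<rho>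
    using w measure_fixed_points[OF n, of "word_eval (sym_group n) \<rho> w"]
    by (simp add: stabilizer_pmf_def pmf.map_comp comp_def pmf_map vimage_def)
  have "perm_dist n (word_eval (sym_group n) \<sigma> w) id
      = tv_dist (map_pmf (\<lambda>A. w \<in> A) (stabilizer_pmf n \<sigma> P)) (map_pmf (\<lambda>A. w \<in> A) (stabilizer_pmf n \<tau> P))"
    using \<tau> perm_dist_nonneg by (simp add: tv_dist_bool *)
  also have "\<dots> \<le> tv_dist (stabilizer_pmf n \<sigma> P) (stabilizer_pmf n \<tau> P)"
    by (intro tv_dist_map_le finite_set_stabilizer_pmf n)
  finally show ?thesis .
qed

text \<open>The pattern of the pullback on \<open>P\<close> is a deterministic function of the
  pattern of \<sigma> on \<open>Q\<close>, which prepares for data processing. \<open>Q\<close> may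
  exceed the image of \<open>P\<close>, leaving room for further test words.\<close>

lemma stabilizer_pmf_substitute:
  assumes h: "h \<in> T \<rightarrow> carrier (free_group S)" and \<sigma>: "\<sigma> \<in> sym_tuples S n"
    and P: "P \<subseteq> carrier (free_group T)" and Q: "word_eval (free_group S) h ` P \<subseteq> Q"
  shows "stabilizer_pmf n (substitute T n h \<sigma>) P
    = map_pmf (\<lambda>A. {w \<in> P. word_eval (free_group S) h w \<in> A}) (stabilizer_pmf n \<sigma> Q)"
proof -
  have "{w \<in> P. word_eval (sym_group n) (substitute T n h \<sigma>) w x = x}
    = {w \<in> P. word_eval (free_group S) h w \<in> {v \<in> Q. word_eval (sym_group n) \<sigma> v x = x}}" for x
    using P Q word_eval_substitute[OF h \<sigma>] by auto
  then show ?thesis by (simp add: stabilizer_pmf_def pmf.map_comp comp_def)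
qed

lemma (in presentation_retract) flexibly_BS_rigid_retract:
  assumes mono: "\<And>n. n \<ge> 1 \<Longrightarrow> mono_on {0<..} (\<lambda>\<epsilon>. \<nu> \<epsilon> n)"
    and rigid: "flexibly_BS_rigid \<nu> S2 E2"
  shows "flexibly_BS_rigid \<nu> S1 E1"
  unfolding flexibly_BS_rigid_def
proof (intro allI impI)
  fix \<epsilon> :: real assume "\<epsilon> > 0"
  then obtain \<epsilon>' \<eta> where \<epsilon>': "\<epsilon>' > 0" and \<eta>: "\<eta> > 0"
    and far: "\<And>n \<sigma>. n \<ge> 1 \<Longrightarrow> \<sigma> \<in> sol_far S1 E1 \<nu> \<epsilon> n \<Longrightarrow>
      substitute S2 n g \<sigma> \<notin> sol_far S2 E2 \<nu> \<epsilon>' n \<Longrightarrow>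
      \<exists>s\<in>S1. \<eta> \<le> perm_dist n (word_eval (sym_group n) \<sigma> (retract_relator s)) id"
    using substitute_far_or_retract_relator_moves[of \<nu> \<epsilon>] mono by metis
  from rigid \<epsilon>' obtain P \<delta> where P: "finite P" "P \<subseteq> carrier (free_group S2)" and \<delta>: "\<delta> > 0"
    and tv: "\<And>n \<sigma> \<tau>. n \<ge> 1 \<Longrightarrow> \<sigma> \<in> sol_far S2 E2 \<nu> \<epsilon>' n \<Longrightarrow> \<tau> \<in> sol S2 E2 n \<Longrightarrow>
      \<delta> \<le> tv_dist (stabilizer_pmf n \<sigma> P) (stabilizer_pmf n \<tau> P)"
    unfolding flexibly_BS_rigid_def by metis
  \<comment> \<open>The images under \<open>g\<close> let \<open>Q\<close> observe all that
    \<open>P\<close> observes of the pullback; the retraction relators cover the case where the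
    pullback is not far.\<close>
  define Q where "Q = word_eval (free_group S1) g ` P \<union> retract_relator ` S1"
  have "finite Q" using P finite_S1 by (simp add: Q_def)
  moreover have "Q \<subseteq> carrier (free_group S1)"
    using P(2) hom_in_carrier[OF word_eval_hom[OF group_free_group g]] retract_relator_closed
    by (auto simp: Q_def)
  moreover have "min \<delta> \<eta> \<le> tv_dist (stabilizer_pmf n \<sigma> Q) (stabilizer_pmf n \<tau> Q)"
    if n: "n \<ge> 1" and \<sigma>: "\<sigma> \<in> sol_far S1 E1 \<nu> \<epsilon> n" and \<tau>: "\<tau> \<in> sol S1 E1 n" for n \<sigma> \<tau>
  proof (cases "substitute S2 n g \<sigma> \<in> sol_far S2 E2 \<nu> \<epsilon>' n")
    case True
    have st: "\<sigma> \<in> sym_tuples S1 n" "\<tau> \<in> sym_tuples S1 n"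
      using \<sigma> \<tau> by (auto simp: sol_far_def sol_def)
    have "substitute S2 n g \<tau> \<in> sol S2 E2 n" by (rule substitute_sol[OF g \<tau> E1 E2 g_relator])
    note tv[OF n True this]
    also have "tv_dist (stabilizer_pmf n (substitute S2 n g \<sigma>) P)
        (stabilizer_pmf n (substitute S2 n g \<tau>) P)
        \<le> tv_dist (stabilizer_pmf n \<sigma> Q) (stabilizer_pmf n \<tau> Q)"
      \<comment> \<open>Both patterns on \<open>P\<close> arise from those on \<open>Q\<close> by
        the same map, so the distance can only shrink.\<close>
      using stabilizer_pmf_substitute[OF g _ P(2), of _ n Q] st n
      by (auto simp: Q_def intro!: tv_dist_map_le finite_set_stabilizer_pmf)
    finally show ?thesis by simp
  next
    case False
    then obtain s where s: "s \<in> S1"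
      "\<eta> \<le> perm_dist n (word_eval (sym_group n) \<sigma> (retract_relator s)) id"
      using far[OF n \<sigma>] by blast
    have "word_eval (sym_group n) \<tau> (retract_relator s) = id"
      using sol_word_eval_normal_closure[OF \<tau> E1] retract[OF s(1)] by (simp add: retract_relator_def)
    then show ?thesis
      using s tv_dist_stabilizer_ge_perm_dist[OF n, of "retract_relator s" Q \<tau> \<sigma>]
      by (fastforce simp: Q_def)
  qed
  ultimately show "\<exists>P \<delta>. finite P \<and> P \<subseteq> carrier (free_group S1) \<and> \<delta> > 0 \<and>
        (\<forall>n\<ge>1. \<forall>\<sigma>\<in>sol_far S1 E1 \<nu> \<epsilon> n. \<forall>\<tau>\<in>sol S1 E1 n.
           tv_dist (stabilizer_pmf n \<sigma> P) (stabilizer_pmf n \<tau> P) \<ge> \<delta>)"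
    using \<delta> \<eta> by (intro exI[of _ Q] exI[of _ "min \<delta> \<eta>"]) simp
qed

section \<open>Flexible stability\<close>

lemma pmf_all_replicate_pmf:
  "pmf (map_pmf (\<lambda>xs. \<forall>x\<in>set xs. R x) (replicate_pmf s p)) True = measure p {x. R x} ^ s"
proof (induction s)
  case (Suc s)
  let ?all = "\<lambda>xs. \<forall>x\<in>set xs. R x"
  \<comment> \<open>Split off the first sample: it is independent of the others, so the joint
    distribution is a product and the probabilities multiply.\<close>
  have "map_pmf ?all (replicate_pmf (Suc s) p)
      = map_pmf (\<lambda>(x, xs). R x \<and> ?all xs) (pair_pmf p (replicate_pmf s p))"
    by (simp add: pair_pmf_def map_pmf_def bind_assoc_pmf bind_return_pmf)
  also have "\<dots> = map_pmf (\<lambda>(a, b). a \<and> b) (pair_pmf (map_pmf R p) (map_pmf ?all (replicate_pmf s p)))"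
    by (simp add: map_pair[symmetric] pmf.map_comp comp_def case_prod_unfold)
  finally have "pmf (map_pmf ?all (replicate_pmf (Suc s) p)) True
      = pmf (pair_pmf (map_pmf R p) (map_pmf ?all (replicate_pmf s p))) (True, True)"
    by (auto simp: pmf_map[of "\<lambda>(a, b). a \<and> b"] vimage_def measure_pmf_single[symmetric]
        intro!: arg_cong[where f = "measure _"])
  then show ?case using Suc by (simp add: pmf_pair pmf_map[of R] vimage_def)
qed simp

text \<open>A round that has drawn \<open>w\<close> rejects with probability equal to the
  displacement of \<open>w\<close>. Averaging over \<open>E0\<close> gives the rejection probability
  of one round, and the rounds are independent.\<close>

lemma pmf_sample_and_substitute:
  assumes n: "n \<ge> 1" and E0: "finite E0" "E0 \<noteq> {}"
  shows "pmf (sample_and_substitute E0 s n \<sigma>) True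
    = (1 - (\<Sum>w\<in>E0. perm_dist n (word_eval (sym_group n) \<sigma> w) id) / card E0) ^ s"
proof -
  let ?ev = "word_eval (sym_group n) \<sigma>"
  let ?A = "{(w, x). ?ev w x = x}"
  have "(E0 \<times> {1..n}) \<inter> ?A = Sigma E0 (\<lambda>w. {1..n} \<inter> {x. ?ev w x = x})" by auto
  then have "measure (pmf_of_set (E0 \<times> {1..n})) ?A
      = (\<Sum>w\<in>E0. real (card ({1..n} \<inter> {x. ?ev w x = x})) / n) / card E0"
    using E0 n by (simp add: measure_pmf_of_set card_SigmaI card_cartesian_product
        sum_divide_distrib[symmetric])
  also have "\<dots> = (\<Sum>w\<in>E0. 1 - perm_dist n (?ev w) id) / card E0"
    using n by (simp add: measure_fixed_points[symmetric] measure_pmf_of_set)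
  also have "\<dots> = 1 - (\<Sum>w\<in>E0. perm_dist n (?ev w) id) / card E0"
    using E0 by (simp add: sum_subtractf diff_divide_distrib)
  finally show ?thesis
    using E0 pmf_all_replicate_pmf[of "\<lambda>(w, x). ?ev w x = x" s "pmf_of_set (E0 \<times> {1..n})"]
    by (simp add: sample_and_substitute_def case_prod_unfold)
qed

text \<open>Amplification: \<open>s\<close> rounds reject with probability at most \<open>s\<close> times that of a single round, and
  with probability close to 1 for large \<open>s\<close> if that of a single round is bounded below.\<close>

lemma flexibly_stable_iff:
  "flexibly_stable \<nu> S E \<longleftrightarrow>
     (\<forall>\<epsilon>>0. \<exists>E0 \<eta>. finite E0 \<and> E0 \<subseteq> E \<and> \<eta> > 0 \<and>
        (\<forall>n\<ge>1. \<forall>\<sigma>\<in>sol_far S E \<nu> \<epsilon> n.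
           \<eta> \<le> (\<Sum>w\<in>E0. perm_dist n (word_eval (sym_group n) \<sigma> w) id)))"
  (is "_ \<longleftrightarrow> (\<forall>\<epsilon>>0. ?R \<epsilon>)")
proof (intro iffI allI impI)
  fix \<epsilon> :: real assume "flexibly_stable \<nu> S E" "\<epsilon> > 0"
  then obtain s E0 where s: "s \<ge> 1" and E0: "finite E0" "E0 \<subseteq> E"
    and rej: "\<And>n \<sigma>. n \<ge> 1 \<Longrightarrow> \<sigma> \<in> sol_far S E \<nu> \<epsilon> n \<Longrightarrow>
      pmf (sample_and_substitute E0 s n \<sigma>) False \<ge> 0.99"
    unfolding flexibly_stable_def by metis
  \<comment> \<open>If one round rejects with probability q, Bernoulli's inequality bounds the
    rejection probability of \<open>s\<close> rounds by s times q, so q is at least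
    \<open>0.99 / s\<close>. The sum is q times the size of a nonempty set, hence at least
    q.\<close>
  have "0.99 / s \<le> (\<Sum>w\<in>E0. perm_dist n (word_eval (sym_group n) \<sigma> w) id)" (is "_ \<le> ?m")
    if n: "n \<ge> 1" and \<sigma>: "\<sigma> \<in> sol_far S E \<nu> \<epsilon> n" for n \<sigma>
  proof -
    \<comment> \<open>With no words the algorithm would always accept, yet it rejects
      \<sigma>.\<close>
    have "E0 \<noteq> {}" using rej[OF n \<sigma>] by (auto simp: sample_and_substitute_def)
    have m: "0 \<le> ?m" "?m \<le> card E0"
      using sum_bounded_above[of E0 "\<lambda>w. perm_dist n (word_eval (sym_group n) \<sigma> w) id" 1]
      by (auto intro!: sum_nonneg simp: perm_dist_nonneg perm_dist_le_1)
    have c: "card E0 \<ge> 1" using E0 \<open>E0 \<noteq> {}\<close> by (simp add: Suc_leI card_gt_0_iff)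
    let ?q = "?m / card E0"
    have "?q \<le> 1" using m c by simp
    then have "1 + real s * (- ?q) \<le> (1 + (- ?q)) ^ s"
      by (intro Bernoulli_inequality) simp
    moreover have "0.99 \<le> 1 - (1 - ?q) ^ s"
      using rej[OF n \<sigma>] pmf_sample_and_substitute[OF n E0(1) \<open>E0 \<noteq> {}\<close>]
      by (simp add: pmf_False_conv_True)
    ultimately have "0.99 \<le> real s * ?q" by simp
    then have "0.99 / s \<le> ?q" using s by (simp add: field_simps)
    also have "?q \<le> ?m" using m(1) c by (simp add: divide_le_eq mult_le_cancel_left1)
    finally show ?thesis .
  qed
  then show "?R \<epsilon>" using E0 s by (intro exI[of _ E0] exI[of _ "0.99 / s"]) auto
next
  assume R: "\<forall>\<epsilon>>0. ?R \<epsilon>"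
  show "flexibly_stable \<nu> S E" unfolding flexibly_stable_def
  proof (intro allI impI)
    fix \<epsilon> :: real assume "\<epsilon> > 0"
    with R obtain E0 \<eta> where E0: "finite E0" "E0 \<subseteq> E" and \<eta>: "\<eta> > 0"
      and m: "\<And>n \<sigma>. n \<ge> 1 \<Longrightarrow> \<sigma> \<in> sol_far S E \<nu> \<epsilon> n \<Longrightarrow>
        \<eta> \<le> (\<Sum>w\<in>E0. perm_dist n (word_eval (sym_group n) \<sigma> w) id)"
      by metis
    show "\<exists>s\<ge>1. \<exists>E0. finite E0 \<and> E0 \<subseteq> E \<and>
        (\<forall>n\<ge>1.
           (\<forall>\<sigma>\<in>sol S E n. pmf (sample_and_substitute E0 s n \<sigma>) True \<ge> 0.99) \<and>
           (\<forall>\<sigma>\<in>sol_far S E \<nu> \<epsilon> n. pmf (sample_and_substitute E0 s n \<sigma>) False \<ge> 0.99))"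
    proof (cases "E0 = {}")
      case True
      \<comment> \<open>The empty sum is below \<eta>, so there are no far tuples, and accepting
        everything is correct with a single round.\<close>
      then show ?thesis
        using m \<eta> by (intro exI[of _ 1] conjI exI[of _ "{}"])
          (fastforce simp: sample_and_substitute_def)+
    next
      case False
      then have c: "0 < real (card E0)" using E0 by (simp add: card_gt_0_iff)
      \<comment> \<open>A bound for the acceptance probability of one round on far tuples. The
        maximum keeps it nonnegative when \<eta> exceeds the size of \<open>E0\<close>.\<close>
      define y where "y = max 0 (1 - \<eta> / card E0)"
      have "y < 1" using \<eta> c by (simp add: y_def)
      then obtain s where s: "y ^ s < 0.01"
        using real_arch_pow_inv[of "0.01" y] by auto
      \<comment> \<open>\<open>s\<close> cannot be 0, since the zeroth power is 1.\<close>
      then have "s \<ge> 1" by (cases s) auto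
      moreover have "pmf (sample_and_substitute E0 s n \<sigma>) True \<ge> 0.99"
        if "n \<ge> 1" "\<sigma> \<in> sol S E n" for n \<sigma>
      proof -
        have "(\<Sum>w\<in>E0. perm_dist n (word_eval (sym_group n) \<sigma> w) id) = 0"
          using that(2) E0(2) by (intro sum.neutral) (auto simp: sol_def)
        then show ?thesis using pmf_sample_and_substitute[OF that(1) E0(1) False] by simp
      qed
      moreover have "pmf (sample_and_substitute E0 s n \<sigma>) False \<ge> 0.99"
        if "n \<ge> 1" "\<sigma> \<in> sol_far S E \<nu> \<epsilon> n" for n \<sigma>
      proof -
        let ?m = "\<Sum>w\<in>E0. perm_dist n (word_eval (sym_group n) \<sigma> w) id"
        have "?m \<le> card E0"
          using sum_bounded_above[of E0 "\<lambda>w. perm_dist n (word_eval (sym_group n) \<sigma> w) id" 1]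
          by (auto simp: perm_dist_le_1)
        then have "0 \<le> 1 - ?m / card E0" using c by simp
        moreover have "1 - ?m / card E0 \<le> y"
          using divide_right_mono[OF m[OF that], of "real (card E0)"] by (simp add: y_def)
        ultimately have "(1 - ?m / card E0) ^ s \<le> y ^ s" by (intro power_mono)
        then show ?thesis
          using s pmf_sample_and_substitute[OF that(1) E0(1) False]
          by (simp add: pmf_False_conv_True)
      qed
      ultimately show ?thesis using E0 by blast
    qed
  qed
qed

text \<open>The test words suggested by the rigidity argument, images under \<open>g\<close> and
  retraction relators, need not belong to \<open>E1\<close>. They lie in its normal closure, so
  their displacement is bounded by that of finitely many elements of \<open>E1\<close>, which serve
  as tests instead.\<close>

lemma (in presentation_retract) flexibly_stable_retract:
  assumes mono: "\<And>n. n \<ge> 1 \<Longrightarrow> mono_on {0<..} (\<lambda>\<epsilon>. \<nu> \<epsilon> n)"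
    and stable: "flexibly_stable \<nu> S2 E2"
  shows "flexibly_stable \<nu> S1 E1"
  unfolding flexibly_stable_iff
proof (intro allI impI)
  fix \<epsilon> :: real assume "\<epsilon> > 0"
  then obtain \<epsilon>' \<eta> where \<epsilon>': "\<epsilon>' > 0" and \<eta>: "\<eta> > 0"
    and far: "\<And>n \<sigma>. n \<ge> 1 \<Longrightarrow> \<sigma> \<in> sol_far S1 E1 \<nu> \<epsilon> n \<Longrightarrow>
      substitute S2 n g \<sigma> \<notin> sol_far S2 E2 \<nu> \<epsilon>' n \<Longrightarrow>
      \<exists>s\<in>S1. \<eta> \<le> perm_dist n (word_eval (sym_group n) \<sigma> (retract_relator s)) id"
    using substitute_far_or_retract_relator_moves[of \<nu> \<epsilon>] mono by metis
  from stable \<epsilon>' obtain A \<theta> where A: "finite A" "A \<subseteq> E2" and \<theta>: "\<theta> > 0"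
    and moves: "\<And>n \<sigma>. n \<ge> 1 \<Longrightarrow> \<sigma> \<in> sol_far S2 E2 \<nu> \<epsilon>' n \<Longrightarrow>
      \<theta> \<le> (\<Sum>w\<in>A. perm_dist n (word_eval (sym_group n) \<sigma> w) id)"
    unfolding flexibly_stable_iff by metis
  define Q where "Q = word_eval (free_group S1) g ` A \<union> retract_relator ` S1"
  have "finite Q" using A finite_S1 by (simp add: Q_def)
  moreover have "controlled S1 E1 w" if "w \<in> Q" for w
    using that A(2) g_relator retract
    by (intro normal_closure_controlled[OF E1]) (auto simp: Q_def retract_relator_def)
  ultimately obtain E0 C where E0: "finite E0" "E0 \<subseteq> E1" and C: "0 < (C :: real)"
    and bound: "\<And>w n \<sigma>. w \<in> Q \<Longrightarrow> \<sigma> \<in> sym_tuples S1 n \<Longrightarrow>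
      perm_dist n (word_eval (sym_group n) \<sigma> w) id
        \<le> C * (\<Sum>e\<in>E0. perm_dist n (word_eval (sym_group n) \<sigma> e) id)"
    using finite_controlled[of Q S1 E1] by blast
  \<comment> \<open>In the first case a total displacement \<theta> is spread over the words of
    \<open>A\<close>, each bounded by \<open>C\<close> times the displacement of \<open>E0\<close>;
    in the second a single relator contributes \<eta>. The \<open>+ 1\<close> covers an empty
    \<open>A\<close>.\<close>
  define \<kappa> where "\<kappa> = min (\<theta> / (card A + 1)) \<eta> / C"
  have "\<kappa> > 0" using \<theta> \<eta> C by (simp add: \<kappa>_def)
  moreover have "\<kappa> \<le> (\<Sum>e\<in>E0. perm_dist n (word_eval (sym_group n) \<sigma> e) id)" (is "_ \<le> ?m")
    if n: "n \<ge> 1" and \<sigma>: "\<sigma> \<in> sol_far S1 E1 \<nu> \<epsilon> n" for n \<sigma>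
  proof -
    have \<sigma>': "\<sigma> \<in> sym_tuples S1 n" using \<sigma> by (simp add: sol_far_def)
    have m: "0 \<le> ?m" by (intro sum_nonneg perm_dist_nonneg)
    have "min (\<theta> / (card A + 1)) \<eta> \<le> C * ?m"
    proof (cases "substitute S2 n g \<sigma> \<in> sol_far S2 E2 \<nu> \<epsilon>' n")
      case True
      note moves[OF n True]
      also have "(\<Sum>w\<in>A. perm_dist n (word_eval (sym_group n) (substitute S2 n g \<sigma>) w) id)
          \<le> card A * (C * ?m)"
      proof (rule sum_bounded_above)
        fix w assume w: "w \<in> A"
        then have "w \<in> carrier (free_group S2)" using A(2) E2 by blast
        then show "perm_dist n (word_eval (sym_group n) (substitute S2 n g \<sigma>) w) id \<le> C * ?m"
          using bound[OF _ \<sigma>', of "word_eval (free_group S1) g w"] w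
          by (simp add: word_eval_substitute[OF g \<sigma>'] Q_def)
      qed
      also have "\<dots> \<le> (card A + 1) * (C * ?m)"
        using C m by (intro mult_right_mono) auto
      finally have "\<theta> / (card A + 1) \<le> C * ?m" by (simp add: field_simps)
      then show ?thesis by simp
    next
      case False
      then obtain s where "s \<in> S1"
        "\<eta> \<le> perm_dist n (word_eval (sym_group n) \<sigma> (retract_relator s)) id"
        using far[OF n \<sigma>] by blast
      then show ?thesis
        using bound[OF _ \<sigma>', of "retract_relator s"] by (fastforce simp: Q_def)
    qed
    then show ?thesis using C by (simp add: \<kappa>_def field_simps)
  qed
  ultimately show "\<exists>E0 \<eta>. finite E0 \<and> E0 \<subseteq> E1 \<and> \<eta> > 0 \<and>
        (\<forall>n\<ge>1. \<forall>\<sigma>\<in>sol_far S1 E1 \<nu> \<epsilon> n.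
           \<eta> \<le> (\<Sum>w\<in>E0. perm_dist n (word_eval (sym_group n) \<sigma> w) id))"
    using E0 by blast
qed

theorem corollary1p21:
  fixes S1 :: "'a set" and S2 :: "'b set"
    and E1 :: "'a fword set" and E2 :: "'b fword set"
    and \<nu> :: "real \<Rightarrow> nat \<Rightarrow> enat"
  assumes "finite S1" and "finite S2"
    and "E1 \<subseteq> carrier (free_group S1)" and "E2 \<subseteq> carrier (free_group S2)"
    and "presented_group S1 E1 \<cong> presented_group S2 E2"
    and "\<And>n. n \<ge> 1 \<Longrightarrow> mono_on {0<..} (\<lambda>\<epsilon>. \<nu> \<epsilon> n)"
  shows "(flexibly_BS_rigid \<nu> S1 E1 \<longleftrightarrow> flexibly_BS_rigid \<nu> S2 E2) \<and>
         (flexibly_stable \<nu> S1 E1 \<longleftrightarrow> flexibly_stable \<nu> S2 E2)"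
proof -
  obtain f g where "presentation_retract S1 E1 S2 E2 f g"
    using presentation_retract_of_iso assms by blast
  then interpret A: presentation_retract S1 E1 S2 E2 f g .
  \<comment> \<open>The converse implications use a retraction in the other direction, with lifts
    chosen anew for the inverse isomorphism.\<close>
  have "presented_group S2 E2 \<cong> presented_group S1 E1"
    using group.iso_sym[OF group_presented_group] assms by blast
  then obtain f' g' where "presentation_retract S2 E2 S1 E1 f' g'"
    using presentation_retract_of_iso assms by blast
  then interpret B: presentation_retract S2 E2 S1 E1 f' g' .
  show ?thesis
    using A.flexibly_BS_rigid_retract A.flexibly_stable_retract
      B.flexibly_BS_rigid_retract B.flexibly_stable_retract assms(6)
    by blast
qed

end
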